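(* For any type of real function $f(t)$, and for any $n=0,1,\ldots$ for which the inverse transform of $s^nL\{f(t)\}$ exists, $$L\{[u(t)f(t)]^{(n)}\}=s^nL\{f(t)\};\qquad n=0,1,\ldots,$$ where $[u(t)f(t)]^{(n)}$ denotes the $n$-th (in general non-ordinary) derivative of the causal function $u(t)f(t)$.
   Context: The Laplace transform of a real function $f(t)$ of the real variable $t$ is $L\{f(t)\}=F(s)=\int_0^\infty f(t)e^{-st}\,dt$, with $s=\sigma+i\omega$, $\sigma>0$. It is understood as equivalent to the bilateral expression $\int_{-\infty}^{+\infty}u(t)f(t)e^{-st}\,dt$, so that $L\{f(t)\}=L\{u(t)f(t)\}$. The inverse transform is $L^{-1}\{F(s)\}=\varphi(t)=\frac{1}{2\pi i}\int_{\sigma-i\infty}^{\sigma+i\infty}F(s)e^{st}\,ds$. It satisfies $L^{-1}\{L\{f(t)\}\}=u(t)f(t)$ for $-\infty<t<+\infty$. The unit step function is $u(t)=\int_{-\infty}^t\delta(\tau)\,d\tau$. Explicitly, $u(t)=0$ for $t<0$, $u(t)=u_0(t)$ at $t=0$, and $u(t)=1$ for $t>0$. Here $u_0(t)$, the unit connect function, is a pseudo-function existing at $t=0$ and conceived of as the infinite set $\{0\ldots1\}$ of real numbers that fills the transition from $u(-0)=0$ to $u(+0)=1$. It can be obtained as the limit for $T\to0$ of a continuous function rising monotonically from $0$ to $1$ in the interval from $0$ to $T$. The non-ordinary derivatives are such that $u^{(n)}(t)=u_0^{(n)}(t)=\delta^{(n-1)}(t)$ for $n=1,2,\ldots$ (the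 impulse functions), with $L\{\delta^{(n)}(t)\}=s^n$ and $u(t)u^{(n)}(t)=u^{(n)}(t)$ for $n=0,1,\ldots$. A function is causal if it is null for $t<0$ and has the form $u(t)f(t)$; the impulse functions are causal. The real function $f(t)$ may be any linear combination of functions that are derivable in the ordinary sense as many times as required (not necessarily causal), causal functions, and impulse functions. Non-ordinary functions and derivatives are treated informally. *)

theory Defs
  imports "HOL-Complex_Analysis.Complex_Analysis"
begin

section \<open>Test functions\<close>

definition smooth :: "(real \<Rightarrow> real) \<Rightarrow> bool" where
  "smooth \<phi> \<longleftrightarrow> (\<forall>n t. (deriv ^^ n) \<phi> differentiable at t)"

definition test_function :: "(real \<Rightarrow> real) \<Rightarrow> bool" where
  "test_function \<phi> \<longleftrightarrow> smooth \<phi> \<and> (\<exists>K. \<forall>t. K < \<bar>t\<bar> \<longrightarrow> \<phi> t = 0)"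

lemma real_differentiableI: "(f has_real_derivative D) (at t) \<Longrightarrow> f differentiable at t"
  for f :: "real \<Rightarrow> real"
  by (auto simp: real_differentiable_def)

lemma smooth_family:
  assumes "P i" and step: "\<And>i. P i \<Longrightarrow> P (D i)"
    and deriv: "\<And>i t. P i \<Longrightarrow> (F i has_real_derivative F (D i) t) (at t)"
  shows "smooth (F i)"
proof -
  have "P ((D ^^ n) i) \<and> (deriv ^^ n) (F i) = F ((D ^^ n) i)" for n
  proof (induction n)
    case (Suc n)
    moreover have "deriv (F ((D ^^ n) i)) = F (D ((D ^^ n) i))"
      by (rule ext, rule DERIV_imp_deriv, rule deriv) (use Suc in blast)
    ultimately show ?case using step by simp
  qed (use assms(1) in simp)
  then show ?thesis
    unfolding smooth_def using deriv real_differentiableI by metis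
qed

lemma smooth_unfold: "smooth f \<longleftrightarrow> (\<forall>t. f differentiable at t) \<and> smooth (deriv f)"
proof -
  have "(\<forall>n. P n) \<longleftrightarrow> P 0 \<and> (\<forall>n. P (Suc n))" for P
    using not0_implies_Suc by metis
  from this[of "\<lambda>n. \<forall>t. (deriv ^^ n) f differentiable at t"]
  show ?thesis by (simp add: smooth_def funpow_swap1)
qed

lemma smooth_deriv: "smooth f \<Longrightarrow> smooth (deriv f)"
  by (drule smooth_unfold[THEN iffD1]) simp

lemma smooth_funpow_deriv: "smooth f \<Longrightarrow> smooth ((deriv ^^ n) f)"
  by (induction n) (auto intro: smooth_deriv)

lemma smooth_has_deriv: "smooth f \<Longrightarrow> (f has_real_derivative deriv f t) (at t)"
  by (simp add: DERIV_deriv_iff_real_differentiable smooth_unfold[THEN iffD1])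

lemma smoothI_deriv:
  assumes "\<And>t. (f has_real_derivative f' t) (at t)" "smooth f'"
  shows "smooth f"
proof -
  have "deriv f = f'" using assms(1) by (auto intro: DERIV_imp_deriv)
  moreover have "\<forall>t. f differentiable at t"
    by (rule allI, rule real_differentiableI, rule assms(1))
  ultimately show ?thesis using assms(2) by (intro smooth_unfold[THEN iffD2]) simp
qed

lemma smooth_continuous: "smooth f \<Longrightarrow> continuous_on A f"
  by (meson DERIV_isCont continuous_at_imp_continuous_on smooth_has_deriv)

lemma smooth_const [simp]: "smooth (\<lambda>t. c)"
  by (rule smooth_family[where F = "\<lambda>c t. c" and P = "\<lambda>_. True" and D = "\<lambda>_. 0"]) simp_all

lemma deriv_lincomb:
  assumes "smooth f" "smooth g"
  shows "deriv (\<lambda>t. a * f t + b * g t) = (\<lambda>t. a * deriv f t + b * deriv g t)"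
proof
  fix t show "deriv (\<lambda>t. a * f t + b * g t) t = a * deriv f t + b * deriv g t"
    by (rule DERIV_imp_deriv) (auto intro!: derivative_eq_intros smooth_has_deriv assms)
qed

lemma smooth_lincomb:
  assumes "smooth f" "smooth g"
  shows "smooth (\<lambda>t. a * f t + b * g t)"
proof -
  let ?F = "\<lambda>p t. a * fst p t + b * snd p t"
  have "smooth (?F (f, g))"
  proof (rule smooth_family[where F = ?F and P = "\<lambda>p. smooth (fst p) \<and> smooth (snd p)"
        and D = "map_prod deriv deriv"])
    fix p :: "(real \<Rightarrow> real) \<times> (real \<Rightarrow> real)" and t
    assume p: "smooth (fst p) \<and> smooth (snd p)"
    have "(?F p has_real_derivative a * deriv (fst p) t + b * deriv (snd p) t) (at t)"
      using p by (intro DERIV_add DERIV_cmult smooth_has_deriv) auto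
    then show "(?F p has_real_derivative ?F (map_prod deriv deriv p) t) (at t)" by simp
  qed (use assms smooth_deriv in auto)
  then show ?thesis by simp
qed

lemma smooth_add: "smooth f \<Longrightarrow> smooth g \<Longrightarrow> smooth (\<lambda>t. f t + g t)"
  using smooth_lincomb[of f g 1 1] by simp

lemma smooth_cmult: "smooth f \<Longrightarrow> smooth (\<lambda>t. a * f t)"
  using smooth_lincomb[of f f a 0] by simp

lemma funpow_deriv_lincomb:
  assumes "smooth f" "smooth g"
  shows "(deriv ^^ n) (\<lambda>t. a * f t + b * g t) = (\<lambda>t. a * (deriv ^^ n) f t + b * (deriv ^^ n) g t)"
  by (induction n) (simp_all add: deriv_lincomb smooth_funpow_deriv assms)

lemma smooth_mult:
  assumes "smooth f" "smooth g"
  shows "smooth (\<lambda>t. f t * g t)"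
proof -
  have "smooth f \<Longrightarrow> smooth g \<Longrightarrow> \<forall>t. (deriv ^^ n) (\<lambda>t. f t * g t) differentiable at t" for n
  proof (induction n arbitrary: f g rule: less_induct)
    case (less n)
    have d: "((\<lambda>t. f t * g t) has_real_derivative f t * deriv g t + deriv f t * g t) (at t)" for t
      by (auto intro!: derivative_eq_intros smooth_has_deriv less.prems)
    show ?case
    proof (cases n)
      case 0
      then show ?thesis using d real_differentiableI by (metis funpow_0)
    next
      case (Suc m)
      have key: "(deriv ^^ k) (\<lambda>t. f t * deriv g t + deriv f t * g t) =
            (\<lambda>t. (deriv ^^ k) (\<lambda>t. f t * deriv g t) t + (deriv ^^ k) (\<lambda>t. deriv f t * g t) t)"
        if "k \<le> m" for k using that
      proof (induction k)
        case (Suc k)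
        have 1: "\<forall>t. (deriv ^^ k) (\<lambda>t. f t * deriv g t) differentiable at t"
          using less.IH[of k f "deriv g"] less.prems Suc.prems \<open>n = Suc m\<close> smooth_deriv by auto
        have 2: "\<forall>t. (deriv ^^ k) (\<lambda>t. deriv f t * g t) differentiable at t"
          using less.IH[of k "deriv f" g] less.prems Suc.prems \<open>n = Suc m\<close> smooth_deriv by auto
        show ?case
        proof
          fix t
          show "(deriv ^^ Suc k) (\<lambda>t. f t * deriv g t + deriv f t * g t) t =
            (deriv ^^ Suc k) (\<lambda>t. f t * deriv g t) t + (deriv ^^ Suc k) (\<lambda>t. deriv f t * g t) t"
            using Suc 1 2
            by (auto intro!: DERIV_imp_deriv derivative_eq_intros
                simp: DERIV_deriv_iff_real_differentiable)
        qed
      qed simp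
      have "(deriv ^^ n) (\<lambda>t. f t * g t) = (deriv ^^ m) (\<lambda>t. f t * deriv g t + deriv f t * g t)"
        using Suc d DERIV_imp_deriv by (metis (no_types, lifting) ext funpow_Suc_right o_apply)
      moreover have "(\<lambda>t. (deriv ^^ m) (\<lambda>t. f t * deriv g t) t + (deriv ^^ m) (\<lambda>t. deriv f t * g t) t)
          differentiable at t" for t
        using less.IH[of m f "deriv g"] less.IH[of m "deriv f" g] less.prems Suc smooth_deriv
        by (auto intro!: differentiable_add)
      ultimately show ?thesis using key[of m] by auto
    qed
  qed
  then show ?thesis using assms unfolding smooth_def by blast
qed

lemma smooth_affine:
  assumes "smooth f" shows "smooth (\<lambda>t. f (a * t + b))"
proof -
  let ?F = "\<lambda>p t. snd p * fst p (a * t + b)"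
  have "smooth (?F (f, 1))"
  proof (rule smooth_family[where F = ?F and P = "\<lambda>p. smooth (fst p)"
        and D = "\<lambda>p. (deriv (fst p), snd p * a)"])
    fix p :: "(real \<Rightarrow> real) \<times> real" and t
    assume p: "smooth (fst p)"
    have "((\<lambda>t. a * t + b) has_real_derivative a) (at t)"
      by (auto intro!: derivative_eq_intros)
    then have "((\<lambda>t. fst p (a * t + b)) has_real_derivative deriv (fst p) (a * t + b) * a) (at t)"
      by (rule DERIV_chain2[OF smooth_has_deriv[OF p]])
    then have "(?F p has_real_derivative snd p * (deriv (fst p) (a * t + b) * a)) (at t)"
      by (rule DERIV_cmult)
    then show "(?F p has_real_derivative ?F (deriv (fst p), snd p * a) t) (at t)"
      by (simp add: mult_ac)
  qed (use assms smooth_deriv in auto)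
  then show ?thesis by simp
qed

lemma smooth_exp: "smooth (\<lambda>t. exp (a * t))"
proof -
  have "smooth (\<lambda>t. 1 * exp (a * t))"
    by (rule smooth_family[where F = "\<lambda>c t. c * exp (a * t)" and P = "\<lambda>_. True" and D = "\<lambda>c. c * a"])
       (auto intro!: derivative_eq_intros)
  then show ?thesis by simp
qed

lemma smooth_cos_sin: "smooth (\<lambda>t. c * cos (a * t) + d * sin (a * t))"
proof -
  let ?F = "\<lambda>p t. fst p * cos (a * t) + snd p * sin (a * t)"
  have "smooth (?F (c, d))"
    by (rule smooth_family[where F = ?F and P = "\<lambda>_. True" and D = "\<lambda>p. (snd p * a, - fst p * a)"])
       (auto intro!: derivative_eq_intros)
  then show ?thesis by simp
qed

lemma smooth_cos: "smooth (\<lambda>t. cos (a * t))" and smooth_sin: "smooth (\<lambda>t. sin (a * t))"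
  using smooth_cos_sin[of 1 a 0] smooth_cos_sin[of 0 a 1] by simp_all

lemma poly_exp_tendsto_0:
  fixes p :: "real poly"
  shows "((\<lambda>y. poly p y * exp (- y)) \<longlongrightarrow> 0) at_top"
proof -
  have "((\<lambda>y. \<Sum>i\<le>degree p. coeff p i * (y ^ i / exp y)) \<longlongrightarrow> (\<Sum>i\<le>degree p. coeff p i * 0)) at_top"
    by (intro tendsto_intros tendsto_power_div_exp_0)
  then show ?thesis
    by (simp add: poly_altdef exp_minus divide_inverse sum_distrib_right mult.assoc)
qed

definition bump_half :: "real poly \<Rightarrow> real \<Rightarrow> real" where
  "bump_half p t = (if t \<le> 0 then 0 else poly p (1 / t) * exp (- (1 / t)))"

lemma bump_half_deriv:
  "(bump_half p has_real_derivative bump_half ([:0, 0, 1:] * (p - pderiv p)) t) (at t)"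
proof -
  consider "t < 0" | "t = 0" | "t > 0" by linarith
  then show ?thesis
  proof cases
    case 1
    have "((\<lambda>_. 0) has_real_derivative 0) (at t)" by simp
    then have "(bump_half p has_real_derivative 0) (at t)"
      by (rule has_field_derivative_transform_within_open[where S = "{..<0}"])
         (use 1 in \<open>auto simp: bump_half_def\<close>)
    then show ?thesis using 1 by (simp add: bump_half_def)
  next
    case 3
    have "((\<lambda>t. poly p (1 / t) * exp (- (1 / t))) has_real_derivative
        bump_half ([:0, 0, 1:] * (p - pderiv p)) t) (at t)"
      using 3 by (auto intro!: derivative_eq_intros DERIV_chain2[OF poly_DERIV]
          simp: bump_half_def field_simps power2_eq_square)
    then show ?thesis
      by (rule has_field_derivative_transform_within_open[where S = "{0<..}"])
         (use 3 in \<open>auto simp: bump_half_def\<close>)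
  next
    case 2
    have "((\<lambda>h. (bump_half p (0 + h) - bump_half p 0) / h) \<longlongrightarrow> 0) (at_right 0)"
    proof -
      have "((\<lambda>h. poly ([:0, 1:] * p) (inverse h) * exp (- (inverse h))) \<longlongrightarrow> 0) (at_right 0)"
        by (rule filterlim_compose[OF poly_exp_tendsto_0 filterlim_inverse_at_top_right])
      then show ?thesis
        by (rule Lim_transform_eventually)
           (auto simp: bump_half_def eventually_at_filter field_simps)
    qed
    moreover have "((\<lambda>h. (bump_half p (0 + h) - bump_half p 0) / h) \<longlongrightarrow> 0) (at_left 0)"
      by (rule Lim_transform_eventually[OF tendsto_const])
         (auto simp: bump_half_def eventually_at_filter)
    ultimately have "((\<lambda>h. (bump_half p (0 + h) - bump_half p 0) / h) \<longlongrightarrow> 0) (at 0)"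
      by (simp add: filterlim_split_at)
    then show ?thesis using 2 by (simp add: DERIV_def bump_half_def)
  qed
qed

lemma smooth_bump_half: "smooth (bump_half p)"
  by (rule smooth_family[where F = bump_half and P = "\<lambda>_. True"
        and D = "\<lambda>p. [:0, 0, 1:] * (p - pderiv p)"])
     (simp_all add: bump_half_deriv del: mult_pCons_left)

lemma smooth_step_exists:
  obtains S :: "real \<Rightarrow> real" where "smooth S" "\<And>t. t \<le> 0 \<Longrightarrow> S t = 0" "\<And>t. 1 \<le> t \<Longrightarrow> S t = 1"
    "\<And>t. 0 \<le> S t" "\<And>t. S t \<le> 1"
proof -
  define b where "b = (\<lambda>t. bump_half 1 t * bump_half 1 (1 - t))"
  have b0: "b t \<ge> 0" for t by (simp add: b_def bump_half_def)
  have bz: "b t = 0" if "t \<le> 0 \<or> t \<ge> 1" for t using that by (auto simp: b_def bump_half_def)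
  have "smooth b" unfolding b_def
    using smooth_mult[OF smooth_bump_half[of 1] smooth_affine[OF smooth_bump_half[of 1], of "-1" 1]]
    by (simp add: add.commute)
  have cont: "continuous_on A b" for A using \<open>smooth b\<close> by (rule smooth_continuous)
  define G where "G = (\<lambda>t. integral {-1..t} b)"
  have dG1: "(G has_real_derivative b t) (at t)" if "t > -1" for t
  proof -
    have "(G has_real_derivative b t) (at t within {-1..t+1})"
      unfolding G_def by (rule integral_has_real_derivative[OF cont]) (use that in auto)
    then show ?thesis using that by (simp add: at_within_Icc_at)
  qed
  have G0: "G t = 0" if "t \<le> 0" for t
  proof -
    have "integral {-1..t} b = integral {-1..t} (\<lambda>_. 0)"
      by (rule integral_cong) (use that bz in auto)
    then show ?thesis by (simp add: G_def)
  qed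
  have dG: "(G has_real_derivative b t) (at t)" for t
  proof (cases "t > -1")
    case False
    have "((\<lambda>_. 0) has_real_derivative 0) (at t)" by simp
    then have "(G has_real_derivative 0) (at t)"
      by (rule has_field_derivative_transform_within_open[where S = "{..<0}"])
         (use False G0 in auto)
    then show ?thesis using False bz by simp
  qed (use dG1 in auto)
  have mono: "G x \<le> G y" if "x \<le> y" for x y
    using DERIV_nonneg_imp_nondecreasing[OF that] dG b0 by blast
  have G1: "G t = G 1" if "1 \<le> t" for t
  proof (cases "t = 1")
    case False
    then have "1 < t" using that by simp
    have "\<exists>z. 1 < z \<and> z < t \<and> G t - G 1 = (t - 1) * b z"
      by (rule MVT2[OF \<open>1 < t\<close>]) (rule dG)
    then show ?thesis using bz by auto
  qed simp
  have "G 1 > 0"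
  proof (rule ccontr)
    assume "\<not> G 1 > 0"
    then have "G 1 = 0" using mono[of 0 1] G0[of 0] by simp
    then have z: "G t = 0" if "t \<in> {0<..<1}" for t
      using mono[of 0 t] mono[of t 1] G0[of 0] that by auto
    have "((\<lambda>_. 0) has_real_derivative 0) (at (1/2 :: real))" by simp
    then have "(G has_real_derivative 0) (at (1/2))"
      by (rule has_field_derivative_transform_within_open[where S = "{0<..<1}"]) (use z in auto)
    then have "b (1/2) = 0" using dG DERIV_unique by blast
    then show False by (simp add: b_def bump_half_def)
  qed
  show thesis
  proof (rule that[of "\<lambda>t. (1 / G 1) * G t"])
    show "smooth (\<lambda>t. (1 / G 1) * G t)"
      by (intro smooth_cmult smoothI_deriv[OF dG \<open>smooth b\<close>])
    show "(1 / G 1) * G t = 0" if "t \<le> 0" for t using G0 that by simp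
    show "(1 / G 1) * G t = 1" if "1 \<le> t" for t using G1[OF that] \<open>G 1 > 0\<close> by simp
    show "0 \<le> (1 / G 1) * G t" for t
      using mono[of 0 t] G0 \<open>G 1 > 0\<close> by (cases "t \<le> 0") auto
    show "(1 / G 1) * G t \<le> 1" for t
      using mono[of t 1] G1[of t] \<open>G 1 > 0\<close> by (cases "t \<le> 1") auto
  qed
qed

lemma test_functionI:
  "smooth \<phi> \<Longrightarrow> (\<And>t. K < \<bar>t\<bar> \<Longrightarrow> \<phi> t = 0) \<Longrightarrow> test_function \<phi>"
  unfolding test_function_def by blast

lemma test_function_smooth: "test_function \<phi> \<Longrightarrow> smooth \<phi>"
  by (simp add: test_function_def)

lemma test_function_zero [simp]: "test_function (\<lambda>t. 0)"
  by (simp add: test_function_def)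

lemma test_function_lincomb:
  assumes "test_function f" "test_function g"
  shows "test_function (\<lambda>t. a * f t + b * g t)"
proof -
  obtain K L where "\<And>t. K < \<bar>t\<bar> \<Longrightarrow> f t = 0" "\<And>t. L < \<bar>t\<bar> \<Longrightarrow> g t = 0"
    using assms unfolding test_function_def by blast
  then show ?thesis
    using assms by (intro test_functionI[where K = "max K L"]) (auto intro: smooth_lincomb test_function_smooth)
qed

lemma test_function_mult:
  assumes "test_function f" "smooth g"
  shows "test_function (\<lambda>t. f t * g t)"
  using assms unfolding test_function_def by (metis mult_zero_left smooth_mult)

lemma test_function_scale:
  assumes "test_function f" "R > 0"
  shows "test_function (\<lambda>t. f (t / R))"
proof -
  obtain K where K: "\<And>t. K < \<bar>t\<bar> \<Longrightarrow> f t = 0"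
    using assms unfolding test_function_def by blast
  have "smooth (\<lambda>t. f (t / R))"
    using smooth_affine[OF test_function_smooth[OF assms(1)], of "1 / R" 0] by simp
  then show ?thesis
    by (rule test_functionI[where K = "K * R"]) (use K assms in \<open>simp add: field_simps\<close>)
qed

lemma deriv_zero_outside:
  assumes "smooth \<phi>" "\<And>t. K < \<bar>t\<bar> \<Longrightarrow> \<phi> t = 0" "K < \<bar>t\<bar>"
  shows "deriv \<phi> t = 0"
proof (rule DERIV_imp_deriv)
  have "open {t :: real. K < \<bar>t\<bar>}" by (intro open_Collect_less continuous_intros)
  have "((\<lambda>_. 0) has_real_derivative 0) (at t)" by simp
  then show "(\<phi> has_real_derivative 0) (at t)"
    by (rule has_field_derivative_transform_within_open[OF _ \<open>open {t. K < \<bar>t\<bar>}\<close>])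
       (use assms in auto)
qed

lemma test_function_deriv: "test_function f \<Longrightarrow> test_function (deriv f)"
  unfolding test_function_def using deriv_zero_outside smooth_deriv by metis

lemma cutoff_exists:
  obtains \<kappa> where "test_function \<kappa>" "\<forall>\<^sub>F t in nhds 0. \<kappa> t = 1"
proof -
  obtain S :: "real \<Rightarrow> real" where S: "smooth S" "\<And>t. t \<le> 0 \<Longrightarrow> S t = 0" "\<And>t. 1 \<le> t \<Longrightarrow> S t = 1"
    using smooth_step_exists by metis
  define \<kappa> where "\<kappa> = (\<lambda>t. S (1 * t + 2) * S (-1 * t + 2))"
  show thesis
  proof (rule that)
    show "test_function \<kappa>"
      unfolding \<kappa>_def
      by (rule test_functionI[where K = 2], intro smooth_mult smooth_affine S(1)) (use S(2) in \<open>auto simp: abs_if split: if_splits\<close>)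
    have "\<forall>\<^sub>F t in nhds (0::real). t \<in> {-1<..<1}"
      by (rule eventually_nhds_in_open) auto
    then show "\<forall>\<^sub>F t in nhds 0. \<kappa> t = 1"
      by (rule eventually_mono) (use S(3) in \<open>auto simp: \<kappa>_def\<close>)
  qed
qed


section \<open>Real distributions on the line\<close>

text \<open>\<open>order_bound K C N T\<close>: on test functions with support in \<open>[-K, K]\<close> the functional \<open>T\<close> is bounded by
  \<open>C\<close> times the maximum of the sup norms of the derivatives of order at most \<open>N\<close>.\<close>

definition order_bound :: "real \<Rightarrow> real \<Rightarrow> nat \<Rightarrow> ((real \<Rightarrow> real) \<Rightarrow> real) \<Rightarrow> bool" where
  "order_bound K C N T \<longleftrightarrow>
     (\<forall>\<phi> M. test_function \<phi> \<longrightarrow> (\<forall>t. K < \<bar>t\<bar> \<longrightarrow> \<phi> t = 0) \<longrightarrow>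
        (\<forall>k\<le>N. \<forall>t. \<bar>(deriv ^^ k) \<phi> t\<bar> \<le> M) \<longrightarrow> \<bar>T \<phi>\<bar> \<le> C * M)"

text \<open>The functional is total in HOL; it is normalised to \<open>0\<close> off the test functions.\<close>

definition distributional :: "((real \<Rightarrow> real) \<Rightarrow> real) \<Rightarrow> bool" where
  "distributional T \<longleftrightarrow>
     (\<forall>\<phi>. \<not> test_function \<phi> \<longrightarrow> T \<phi> = 0) \<and>
     (\<forall>a b \<phi> \<psi>. test_function \<phi> \<longrightarrow> test_function \<psi> \<longrightarrow>
        T (\<lambda>t. a * \<phi> t + b * \<psi> t) = a * T \<phi> + b * T \<psi>) \<and>
     (\<forall>K. \<exists>C N. order_bound K C N T)"

lemma order_boundD:
  "order_bound K C N T \<Longrightarrow> test_function \<phi> \<Longrightarrow> \<forall>t. K < \<bar>t\<bar> \<longrightarrow> \<phi> t = 0 \<Longrightarrow>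
    \<forall>k\<le>N. \<forall>t. \<bar>(deriv ^^ k) \<phi> t\<bar> \<le> M \<Longrightarrow> \<bar>T \<phi>\<bar> \<le> C * M"
  unfolding order_bound_def by iprover

lemma order_boundI:
  "(\<And>\<phi> M. test_function \<phi> \<Longrightarrow> \<forall>t. K < \<bar>t\<bar> \<longrightarrow> \<phi> t = 0 \<Longrightarrow>
    \<forall>k\<le>N. \<forall>t. \<bar>(deriv ^^ k) \<phi> t\<bar> \<le> M \<Longrightarrow> \<bar>T \<phi>\<bar> \<le> C * M) \<Longrightarrow> order_bound K C N T"
  unfolding order_bound_def by iprover

lemma distributionalI:
  assumes "\<And>\<phi>. \<not> test_function \<phi> \<Longrightarrow> T \<phi> = 0"
    and "\<And>a b \<phi> \<psi>. test_function \<phi> \<Longrightarrow> test_function \<psi> \<Longrightarrow>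
        T (\<lambda>t. a * \<phi> t + b * \<psi> t) = a * T \<phi> + b * T \<psi>"
    and "\<And>K. \<exists>C N. order_bound K C N T"
  shows "distributional T"
  unfolding distributional_def using assms by simp

lemma distributional_off: "distributional T \<Longrightarrow> \<not> test_function \<phi> \<Longrightarrow> T \<phi> = 0"
  by (simp add: distributional_def)

lemma distributional_linear:
  "distributional T \<Longrightarrow> test_function \<phi> \<Longrightarrow> test_function \<psi> \<Longrightarrow>
    T (\<lambda>t. a * \<phi> t + b * \<psi> t) = a * T \<phi> + b * T \<psi>"
  by (simp add: distributional_def)

lemma distributional_bound:
  assumes "distributional T"
  obtains C N where "order_bound K C N T"
proof -
  have "\<exists>C N. order_bound K C N T" using assms by (simp add: distributional_def)
  then show thesis by (elim exE) (rule that)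
qed

lemma distributional_lincomb:
  assumes T: "distributional T" and S: "distributional S"
  shows "distributional (\<lambda>\<phi>. a * T \<phi> + b * S \<phi>)"
proof (rule distributionalI)
  fix K
  obtain C N where C: "order_bound K C N T" by (rule distributional_bound[OF T])
  obtain C' N' where C': "order_bound K C' N' S" by (rule distributional_bound[OF S])
  have "order_bound K (\<bar>a\<bar> * C + \<bar>b\<bar> * C') (max N N') (\<lambda>\<phi>. a * T \<phi> + b * S \<phi>)"
  proof (rule order_boundI)
    fix \<phi> M
    assume \<phi>: "test_function \<phi>" "\<forall>t. K < \<bar>t\<bar> \<longrightarrow> \<phi> t = 0"
      "\<forall>k\<le>max N N'. \<forall>t. \<bar>(deriv ^^ k) \<phi> t\<bar> \<le> M"
    have "\<bar>a * T \<phi> + b * S \<phi>\<bar> \<le> \<bar>a\<bar> * \<bar>T \<phi>\<bar> + \<bar>b\<bar> * \<bar>S \<phi>\<bar>"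
      using abs_triangle_ineq[of "a * T \<phi>" "b * S \<phi>"] by (simp add: abs_mult)
    also have "\<dots> \<le> \<bar>a\<bar> * (C * M) + \<bar>b\<bar> * (C' * M)"
      by (intro add_mono mult_left_mono order_boundD[OF C] order_boundD[OF C'] \<phi>(1,2))
         (simp_all add: \<phi>(3))
    finally show "\<bar>a * T \<phi> + b * S \<phi>\<bar> \<le> (\<bar>a\<bar> * C + \<bar>b\<bar> * C') * M"
      by (simp add: algebra_simps)
  qed
  then show "\<exists>C N. order_bound K C N (\<lambda>\<phi>. a * T \<phi> + b * S \<phi>)" by blast
next
  fix \<phi> assume "\<not> test_function \<phi>"
  then show "a * T \<phi> + b * S \<phi> = 0"
    by (simp add: distributional_off[OF T] distributional_off[OF S])
next
  fix c d \<phi> \<psi> assume *: "test_function \<phi>" "test_function \<psi>"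
  show "a * T (\<lambda>t. c * \<phi> t + d * \<psi> t) + b * S (\<lambda>t. c * \<phi> t + d * \<psi> t) =
      c * (a * T \<phi> + b * S \<phi>) + d * (a * T \<psi> + b * S \<psi>)"
    by (simp add: distributional_linear[OF T *] distributional_linear[OF S *] algebra_simps)
qed

lemma distributional_zero: "distributional (\<lambda>_. 0)"
  by (rule distributionalI) (auto simp: order_bound_def intro!: exI[of _ 0])

typedef distribution = "{T. distributional T}"
  morphisms pairing Distribution
  using distributional_zero by blast

setup_lifting type_definition_distribution

instantiation distribution :: real_vector
begin

lift_definition zero_distribution :: distribution is "\<lambda>\<phi>. 0"
  by (rule distributional_zero)

lift_definition plus_distribution :: "distribution \<Rightarrow> distribution \<Rightarrow> distribution"
  is "\<lambda>T S \<phi>. T \<phi> + S \<phi>"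
proof -
  fix T S assume "distributional T" "distributional S"
  then show "distributional (\<lambda>\<phi>. T \<phi> + S \<phi>)"
    using distributional_lincomb[of T S 1 1] by simp
qed

lift_definition uminus_distribution :: "distribution \<Rightarrow> distribution" is "\<lambda>T \<phi>. - T \<phi>"
proof -
  fix T assume "distributional T"
  then show "distributional (\<lambda>\<phi>. - T \<phi>)"
    using distributional_lincomb[of T T "-1" 0] by simp
qed

lift_definition minus_distribution :: "distribution \<Rightarrow> distribution \<Rightarrow> distribution"
  is "\<lambda>T S \<phi>. T \<phi> - S \<phi>"
proof -
  fix T S assume "distributional T" "distributional S"
  then show "distributional (\<lambda>\<phi>. T \<phi> - S \<phi>)"
    using distributional_lincomb[of T S 1 "-1"] by simp
qed

lift_definition scaleR_distribution :: "real \<Rightarrow> distribution \<Rightarrow> distribution" is "\<lambda>a T \<phi>. a * T \<phi>"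
proof -
  fix a T assume "distributional T"
  then show "distributional (\<lambda>\<phi>. a * T \<phi>)"
    using distributional_lincomb[of T T a 0] by simp
qed

instance
proof
  fix a b c :: distribution and x y :: real
  show "a + b + c = a + (b + c)" by transfer (simp add: add.assoc)
  show "a + b = b + a" by transfer (simp add: add.commute)
  show "0 + a = a" by transfer simp
  show "- a + a = 0" by transfer simp
  show "a - b = a + - b" by transfer simp
  show "x *\<^sub>R (a + b) = x *\<^sub>R a + x *\<^sub>R b" by transfer (simp add: distrib_left)
  show "(x + y) *\<^sub>R a = x *\<^sub>R a + y *\<^sub>R a" by transfer (simp add: distrib_right)
  show "x *\<^sub>R y *\<^sub>R a = (x * y) *\<^sub>R a" by transfer (simp add: mult.assoc)
  show "1 *\<^sub>R a = a" by transfer simp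
qed
end

lemma distribution_eqI:
  assumes "\<And>\<phi>. test_function \<phi> \<Longrightarrow> pairing T \<phi> = pairing S \<phi>"
  shows "T = S"
proof -
  have "pairing T \<phi> = pairing S \<phi>" for \<phi>
    using assms pairing[of T] pairing[of S]
    by (cases "test_function \<phi>") (simp_all add: distributional_off)
  then have "pairing T = pairing S" by (rule ext)
  then show ?thesis by (simp add: pairing_inject)
qed

lemma pairing_lincomb:
  assumes "test_function \<phi>" "test_function \<psi>"
  shows "pairing T (\<lambda>t. a * \<phi> t + b * \<psi> t) = a * pairing T \<phi> + b * pairing T \<psi>"
  using pairing[of T] assms by (intro distributional_linear) auto

lemma pairing_add: "pairing (T + S) \<phi> = pairing T \<phi> + pairing S \<phi>"
  by transfer simp

lemma pairing_diff: "pairing (T - S) \<phi> = pairing T \<phi> - pairing S \<phi>"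
  by transfer simp

lemma pairing_scaleR: "pairing (a *\<^sub>R T) \<phi> = a * pairing T \<phi>"
  by transfer simp

lemma pairing_0: "pairing 0 \<phi> = 0"
  by transfer simp

lift_definition dist_deriv :: "distribution \<Rightarrow> distribution"
  is "\<lambda>T \<phi>. if test_function \<phi> then - T (deriv \<phi>) else 0"
proof -
  fix T assume T: "distributional T"
  show "distributional (\<lambda>\<phi>. if test_function \<phi> then - T (deriv \<phi>) else 0)"
  proof (rule distributionalI)
    fix a b \<phi> \<psi> assume \<phi>: "test_function \<phi>" "test_function \<psi>"
    then have "deriv (\<lambda>t. a * \<phi> t + b * \<psi> t) = (\<lambda>t. a * deriv \<phi> t + b * deriv \<psi> t)"
      by (intro deriv_lincomb test_function_smooth)
    moreover have "T (\<lambda>t. a * deriv \<phi> t + b * deriv \<psi> t) = a * T (deriv \<phi>) + b * T (deriv \<psi>)"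
      by (intro distributional_linear[OF T] test_function_deriv \<phi>)
    ultimately show "(if test_function (\<lambda>t. a * \<phi> t + b * \<psi> t) then - T (deriv (\<lambda>t. a * \<phi> t + b * \<psi> t)) else 0) =
       a * (if test_function \<phi> then - T (deriv \<phi>) else 0) + b * (if test_function \<psi> then - T (deriv \<psi>) else 0)"
      by (simp add: \<phi> test_function_lincomb)
  next
    fix K
    obtain C N where C: "order_bound K C N T" by (rule distributional_bound[OF T])
    have "order_bound K C (Suc N) (\<lambda>\<phi>. if test_function \<phi> then - T (deriv \<phi>) else 0)"
    proof (rule order_boundI)
      fix \<phi> M
      assume \<phi>: "test_function \<phi>" "\<forall>t. K < \<bar>t\<bar> \<longrightarrow> \<phi> t = 0" "\<forall>k\<le>Suc N. \<forall>t. \<bar>(deriv ^^ k) \<phi> t\<bar> \<le> M"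
      have "\<bar>(deriv ^^ k) (deriv \<phi>) t\<bar> \<le> M" if "k \<le> N" for k t
        using \<phi>(3)[rule_format, of "Suc k" t] that by (simp add: funpow_swap1)
      moreover have "\<forall>t. K < \<bar>t\<bar> \<longrightarrow> deriv \<phi> t = 0"
        using deriv_zero_outside[OF test_function_smooth[OF \<phi>(1)], of K] \<phi>(2) by simp
      ultimately have "\<bar>T (deriv \<phi>)\<bar> \<le> C * M"
        by (intro order_boundD[OF C] test_function_deriv \<phi>(1)) simp_all
      then show "\<bar>if test_function \<phi> then - T (deriv \<phi>) else 0\<bar> \<le> C * M"
        by (simp add: \<phi>(1))
    qed
    then show "\<exists>C N. order_bound K C N (\<lambda>\<phi>. if test_function \<phi> then - T (deriv \<phi>) else 0)" by blast
  qed simp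
qed

lemma pairing_deriv: "test_function \<phi> \<Longrightarrow> pairing (dist_deriv T) \<phi> = - pairing T (deriv \<phi>)"
  by transfer simp

definition locally_integrable :: "(real \<Rightarrow> real) \<Rightarrow> bool" where
  "locally_integrable g \<longleftrightarrow> (\<forall>a b. set_integrable lborel {a..b} g)"

lemma locally_integrableD:
  "locally_integrable g \<Longrightarrow> integrable lborel (\<lambda>t. indicat_real {a..b} t * g t)"
  by (simp add: locally_integrable_def set_integrable_def)

lemma locally_integrable_measurable:
  assumes "locally_integrable g" shows "g \<in> borel_measurable borel"
proof -
  have m: "(\<lambda>t. indicat_real {- real n..real n} t * g t) \<in> borel_measurable borel" for n :: nat
    using borel_measurable_integrable[OF locally_integrableD[OF assms]] by simp
  have "(\<lambda>n. indicat_real {- real n..real n} t * g t) \<longlonglongrightarrow> g t" for t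
  proof (rule tendsto_eventually)
    obtain m where "\<bar>t\<bar> \<le> real m" using real_arch_simple by blast
    then show "\<forall>\<^sub>F n in sequentially. indicat_real {- real n..real n} t * g t = g t"
      by (intro eventually_sequentiallyI[of m]) (auto simp: indicator_def)
  qed
  then show ?thesis by (intro borel_measurable_LIMSEQ_real[OF _ m]) auto
qed

lemma continuous_imp_locally_integrable:
  "continuous_on UNIV g \<Longrightarrow> locally_integrable g"
  unfolding locally_integrable_def
  by (metis borel_integrable_atLeastAtMost' continuous_on_subset subset_UNIV)

lemma integrable_locally_integrable_times:
  fixes \<phi> :: "real \<Rightarrow> 'b::{banach, second_countable_topology}"
  assumes "locally_integrable g" and cont: "continuous_on UNIV \<phi>" and K: "\<And>t. K < \<bar>t\<bar> \<Longrightarrow> \<phi> t = 0"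
  shows "integrable lborel (\<lambda>t. g t *\<^sub>R \<phi> t)"
proof -
  have "compact (\<phi> ` {-K..K})"
    by (intro compact_continuous_image continuous_on_subset[OF cont]) auto
  then have "bounded (\<phi> ` {-K..K})" by (rule compact_imp_bounded)
  then obtain M where "\<forall>x\<in>\<phi> ` {-K..K}. norm x \<le> M" unfolding bounded_iff by blast
  then have M: "norm (\<phi> t) \<le> M" if "\<bar>t\<bar> \<le> K" for t
    using that by (auto simp: abs_le_iff)
  have i: "integrable lborel (\<lambda>t. M * (indicat_real {-K..K} t * g t))"
    by (intro integrable_mult_right locally_integrableD assms(1))
  have "\<phi> \<in> borel_measurable borel" using cont by (rule borel_measurable_continuous_onI)
  then have me: "(\<lambda>t. g t *\<^sub>R \<phi> t) \<in> borel_measurable lborel"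
    using locally_integrable_measurable[OF assms(1)] by simp
  show ?thesis
  proof (rule Bochner_Integration.integrable_bound[OF i me], rule AE_I2)
    fix t show "norm (g t *\<^sub>R \<phi> t) \<le> norm (M * (indicat_real {-K..K} t * g t))"
    proof (cases "\<bar>t\<bar> \<le> K")
      case True
      then have "norm (g t *\<^sub>R \<phi> t) \<le> \<bar>g t\<bar> * \<bar>M\<bar>"
        using M[OF True] by (auto intro!: mult_left_mono)
      then show ?thesis using True by (simp add: abs_mult indicator_def abs_le_iff mult.commute)
    next
      case False then show ?thesis using K[of t] by simp
    qed
  qed
qed

lemma integrable_times_test_function:
  assumes "locally_integrable g" "test_function \<phi>"
  shows "integrable lborel (\<lambda>t. g t * \<phi> t)"
proof -
  obtain K where "\<And>t. K < \<bar>t\<bar> \<Longrightarrow> \<phi> t = 0" using assms(2) unfolding test_function_def by blast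
  from integrable_locally_integrable_times[OF assms(1) _ this]
  show ?thesis using assms(2) by (simp add: smooth_continuous test_function_smooth)
qed

lift_definition regular :: "(real \<Rightarrow> real) \<Rightarrow> distribution"
  is "\<lambda>g \<phi>. if locally_integrable g \<and> test_function \<phi> then LINT t|lborel. g t * \<phi> t else 0"
proof -
  fix g
  show "distributional (\<lambda>\<phi>. if locally_integrable g \<and> test_function \<phi> then LINT t|lborel. g t * \<phi> t else 0)"
  proof (cases "locally_integrable g")
    case True
    note int = integrable_times_test_function[OF True]
    have "distributional (\<lambda>\<phi>. if test_function \<phi> then LINT t|lborel. g t * \<phi> t else 0)"
    proof (rule distributionalI)
      fix a b \<phi> \<psi> assume *: "test_function \<phi>" "test_function \<psi>"
      have "(LINT t|lborel. g t * (a * \<phi> t + b * \<psi> t)) = (LINT t|lborel. a * (g t * \<phi> t) + b * (g t * \<psi> t))"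
        by (simp add: algebra_simps)
      then show "(if test_function (\<lambda>t. a * \<phi> t + b * \<psi> t) then LINT t|lborel. g t * (a * \<phi> t + b * \<psi> t) else 0) =
          a * (if test_function \<phi> then LINT t|lborel. g t * \<phi> t else 0) +
          b * (if test_function \<psi> then LINT t|lborel. g t * \<psi> t else 0)"
        using * int test_function_lincomb by simp
    next
      fix K
      have i: "integrable lborel (\<lambda>t. indicat_real {-K..K} t * g t)"
        by (rule locally_integrableD[OF True])
      have "order_bound K (LINT t|lborel. \<bar>indicat_real {-K..K} t * g t\<bar>) 0
          (\<lambda>\<phi>. if test_function \<phi> then LINT t|lborel. g t * \<phi> t else 0)"
      proof (rule order_boundI)
        fix \<phi> M
        assume *: "test_function \<phi>" "\<forall>t. K < \<bar>t\<bar> \<longrightarrow> \<phi> t = 0" "\<forall>k\<le>0. \<forall>t. \<bar>(deriv ^^ k) \<phi> t\<bar> \<le> M"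
        have "\<bar>LINT t|lborel. g t * \<phi> t\<bar> \<le> (LINT t|lborel. \<bar>g t * \<phi> t\<bar>)"
          by (rule integral_abs_bound)
        also have "\<dots> \<le> (LINT t|lborel. \<bar>indicat_real {-K..K} t * g t\<bar> * M)"
        proof (rule integral_mono)
          show "integrable lborel (\<lambda>t. \<bar>g t * \<phi> t\<bar>)" using int[OF *(1)] by (rule integrable_abs)
          show "integrable lborel (\<lambda>t. \<bar>indicat_real {-K..K} t * g t\<bar> * M)"
            using integrable_abs[OF i] by simp
          fix t
          have "\<bar>\<phi> t\<bar> \<le> M" using *(3) by simp
          then show "\<bar>g t * \<phi> t\<bar> \<le> \<bar>indicat_real {-K..K} t * g t\<bar> * M"
            using *(2) by (cases "\<bar>t\<bar> \<le> K") (auto simp: abs_mult indicator_def abs_le_iff intro!: mult_left_mono)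
        qed
        finally show "\<bar>if test_function \<phi> then LINT t|lborel. g t * \<phi> t else 0\<bar>
            \<le> (LINT t|lborel. \<bar>indicat_real {-K..K} t * g t\<bar>) * M"
          using *(1) by simp
      qed
      then show "\<exists>C N. order_bound K C N (\<lambda>\<phi>. if test_function \<phi> then LINT t|lborel. g t * \<phi> t else 0)"
        by blast
    qed simp
    then show ?thesis using True by simp
  qed (simp add: distributional_zero)
qed

lemma pairing_regular:
  "locally_integrable g \<Longrightarrow> test_function \<phi> \<Longrightarrow> pairing (regular g) \<phi> = (LINT t|lborel. g t * \<phi> t)"
  by transfer simp

lift_definition delta :: distribution is "\<lambda>\<phi>. if test_function \<phi> then \<phi> 0 else 0"
proof (rule distributionalI)
  fix K
  have "order_bound K 1 0 (\<lambda>\<phi>. if test_function \<phi> then \<phi> 0 else 0)"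
    by (rule order_boundI) simp
  then show "\<exists>C N. order_bound K C N (\<lambda>\<phi>. if test_function \<phi> then \<phi> 0 else 0)" by blast
qed (simp_all add: test_function_lincomb)

lemma pairing_delta: "test_function \<phi> \<Longrightarrow> pairing delta \<phi> = \<phi> 0"
  by transfer simp

definition impulse :: "nat \<Rightarrow> distribution" where
  "impulse n = (dist_deriv ^^ n) delta"

text \<open>The unit step; as a distribution it does not depend on the value chosen at \<open>0\<close>.\<close>

definition unit_step :: "real \<Rightarrow> real" where
  "unit_step t = (if t < 0 then 0 else 1)"


text \<open>Being null on the open half-line \<open>t < 0\<close>.\<close>

definition causal :: "distribution \<Rightarrow> bool" where
  "causal T \<longleftrightarrow>
     (\<forall>\<phi> c. test_function \<phi> \<longrightarrow> c < 0 \<longrightarrow> (\<forall>t\<ge>c. \<phi> t = 0) \<longrightarrow> pairing T \<phi> = 0)"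

lemma causalD: "causal T \<Longrightarrow> test_function \<phi> \<Longrightarrow> c < 0 \<Longrightarrow> (\<And>t. c \<le> t \<Longrightarrow> \<phi> t = 0) \<Longrightarrow> pairing T \<phi> = 0"
  unfolding causal_def by metis

lemma causalI:
  "(\<And>\<phi> c. test_function \<phi> \<Longrightarrow> c < 0 \<Longrightarrow> (\<And>t. c \<le> t \<Longrightarrow> \<phi> t = 0) \<Longrightarrow> pairing T \<phi> = 0) \<Longrightarrow> causal T"
  unfolding causal_def by simp

lemma causal_lincomb: "causal T \<Longrightarrow> causal S \<Longrightarrow> causal (a *\<^sub>R T + b *\<^sub>R S)"
  by (rule causalI) (simp add: pairing_add pairing_scaleR causalD)

lemma causal_0: "causal 0"
  by (rule causalI) (simp add: pairing_0)

lemma causal_add: "causal T \<Longrightarrow> causal S \<Longrightarrow> causal (T + S)"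
  using causal_lincomb[of T S 1 1] by simp

lemma causal_diff: "causal T \<Longrightarrow> causal S \<Longrightarrow> causal (T - S)"
  using causal_lincomb[of T S 1 "-1"] by simp

lemma causal_deriv:
  assumes "causal T" shows "causal (dist_deriv T)"
proof (rule causalI)
  fix \<phi> :: "real \<Rightarrow> real" and c :: real
  assume \<phi>: "test_function \<phi>" "c < 0" "\<And>t. c \<le> t \<Longrightarrow> \<phi> t = 0"
  have "deriv \<phi> t = 0" if "c / 2 \<le> t" for t
  proof (rule DERIV_imp_deriv)
    have "((\<lambda>_. 0) has_real_derivative 0) (at t)" by simp
    then show "(\<phi> has_real_derivative 0) (at t)"
      by (rule has_field_derivative_transform_within_open[where S = "{c<..}"])
         (use \<phi>(2,3) that in auto)
  qed
  then have "pairing T (deriv \<phi>) = 0"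
    by (intro causalD[OF assms test_function_deriv[OF \<phi>(1)], where c = "c / 2"]) (use \<phi>(2) in auto)
  then show "pairing (dist_deriv T) \<phi> = 0" using \<phi>(1) by (simp add: pairing_deriv)
qed

lemma causal_funpow_deriv: "causal T \<Longrightarrow> causal ((dist_deriv ^^ n) T)"
  by (induction n) (simp_all add: causal_deriv)

lemma causal_impulse: "causal (impulse n)"
  unfolding impulse_def
  by (intro causal_funpow_deriv causalI) (simp add: pairing_delta)

lemma locally_integrable_lincomb:
  "locally_integrable f \<Longrightarrow> locally_integrable g \<Longrightarrow> locally_integrable (\<lambda>t. a * f t + b * g t)"
  unfolding locally_integrable_def by (auto intro!: set_integral_add set_integrable_mult_right)

lemma locally_integrable_0: "locally_integrable (\<lambda>t. 0)"
  by (rule continuous_imp_locally_integrable) simp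

lemma unit_step_measurable: "unit_step \<in> borel_measurable borel"
  unfolding unit_step_def by measurable

lemma locally_integrable_unit_step:
  assumes "locally_integrable g" shows "locally_integrable (\<lambda>t. unit_step t * g t)"
  unfolding locally_integrable_def
proof (intro allI)
  fix a b
  have "set_integrable lborel {a..b} g" using assms by (simp add: locally_integrable_def)
  then show "set_integrable lborel {a..b} (\<lambda>t. unit_step t * g t)"
  proof (rule set_integrable_bound)
    show "set_borel_measurable lborel {a..b} (\<lambda>t. unit_step t * g t)"
      unfolding set_borel_measurable_def
      using unit_step_measurable locally_integrable_measurable[OF assms] by measurable
  qed (auto simp: unit_step_def)
qed

lemma regular_lincomb:
  assumes "locally_integrable f" "locally_integrable g"
  shows "regular (\<lambda>t. a * f t + b * g t) = a *\<^sub>R regular f + b *\<^sub>R regular g"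
proof (rule distribution_eqI)
  fix \<phi> :: "real \<Rightarrow> real" assume \<phi>: "test_function \<phi>"
  have "(LINT t|lborel. (a * f t + b * g t) * \<phi> t) = (LINT t|lborel. a * (f t * \<phi> t) + b * (g t * \<phi> t))"
    by (simp add: algebra_simps)
  then show "pairing (regular (\<lambda>t. a * f t + b * g t)) \<phi> = pairing (a *\<^sub>R regular f + b *\<^sub>R regular g) \<phi>"
    by (simp add: pairing_regular locally_integrable_lincomb assms \<phi> pairing_add pairing_scaleR
        integrable_times_test_function)
qed

lemma dist_deriv_unit_step: "dist_deriv (regular unit_step) = delta"
proof (rule distribution_eqI)
  fix \<phi> :: "real \<Rightarrow> real" assume \<phi>: "test_function \<phi>"
  have li: "locally_integrable unit_step"
    using locally_integrable_unit_step[OF continuous_imp_locally_integrable[of "\<lambda>_. 1"]] by simp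
  obtain K0 where K0: "\<And>t. K0 < \<bar>t\<bar> \<Longrightarrow> \<phi> t = 0" using \<phi> unfolding test_function_def by blast
  define K where "K = \<bar>K0\<bar> + 1"
  have K: "0 < K" "\<phi> K = 0" unfolding K_def using K0 by auto
  note sm = test_function_smooth[OF \<phi>]
  have "unit_step t * deriv \<phi> t = indicat_real {0..K} t *\<^sub>R deriv \<phi> t" for t
  proof (cases "K0 < \<bar>t\<bar>")
    case True
    then have "deriv \<phi> t = 0" by (intro deriv_zero_outside[OF sm K0])
    then show ?thesis by simp
  next
    case False
    then show ?thesis by (auto simp: unit_step_def indicator_def K_def)
  qed
  then have "(LINT t|lborel. unit_step t * deriv \<phi> t) = (LINT t|lborel. indicat_real {0..K} t *\<^sub>R deriv \<phi> t)"
    by (simp only:)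
  also have "\<dots> = \<phi> K - \<phi> 0"
  proof (rule integral_FTC_atLeastAtMost)
    show "(\<phi> has_vector_derivative deriv \<phi> t) (at t within {0..K})" for t
      using smooth_has_deriv[OF sm]
      by (simp add: has_real_derivative_iff_has_vector_derivative has_vector_derivative_at_within)
  qed (use K in \<open>auto intro: smooth_continuous smooth_deriv sm\<close>)
  finally show "pairing (dist_deriv (regular unit_step)) \<phi> = pairing delta \<phi>"
    using K(2) by (simp add: pairing_deriv pairing_regular li \<phi> test_function_deriv pairing_delta)
qed

section \<open>The admissible functions and their product with the unit step\<close>

text \<open>Ordinary functions enter through \<open>regular\<close>; local integrability is all that is needed, and every
  continuous, hence every differentiable, function has it.  Causal functions need not be ordinary.\<close>

definition real_functions :: "distribution set" where
  "real_functions = span (regular ` {g. locally_integrable g} \<union> {T. causal T} \<union> range impulse)"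

text \<open>\<open>u\<close> multiplies ordinary functions pointwise and leaves causal ones unchanged; the product is
  independent of the decomposition by \<open>times_step_eq\<close>.\<close>

definition times_step :: "distribution \<Rightarrow> distribution" where
  "times_step f = (THE h. \<exists>g T. locally_integrable g \<and> causal T \<and>
     f = regular g + T \<and> h = regular (\<lambda>t. unit_step t * g t) + T)"

lemma real_functions_iff:
  "f \<in> real_functions \<longleftrightarrow> (\<exists>g T. locally_integrable g \<and> causal T \<and> f = regular g + T)"
proof
  let ?R = "{regular g + T |g T. locally_integrable g \<and> causal T}"
  have R: "regular g + T \<in> ?R" if "locally_integrable g" "causal T" for g T using that by blast
  have "regular (\<lambda>t. 0) = 0"
    using regular_lincomb[OF locally_integrable_0 locally_integrable_0, of 0 0] by simp
  then have R0: "T \<in> ?R" if "causal T" for T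
    using R[OF locally_integrable_0 that] by simp
  have R1: "regular g \<in> ?R" if "locally_integrable g" for g
    using R[OF that causal_0] by simp
  have "subspace ?R"
  proof (rule subspaceI)
    show "0 \<in> ?R" by (rule R0[OF causal_0])
  next
    fix x y assume "x \<in> ?R" "y \<in> ?R"
    then obtain g T h S where *: "x = regular g + T" "y = regular h + S"
      "locally_integrable g" "causal T" "locally_integrable h" "causal S" by blast
    have "x + y = regular (\<lambda>t. 1 * g t + 1 * h t) + (T + S)"
      by (simp only: regular_lincomb *) (simp add: algebra_simps)
    then show "x + y \<in> ?R"
      using R[OF locally_integrable_lincomb[OF *(3,5)] causal_add[OF *(4,6)]] by (simp only:)
  next
    fix c x assume "x \<in> ?R"
    then obtain g T where *: "x = regular g + T" "locally_integrable g" "causal T" by blast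
    have "c *\<^sub>R x = regular (\<lambda>t. c * g t + 0 * g t) + (c *\<^sub>R T + 0 *\<^sub>R T)"
      by (simp only: regular_lincomb *) (simp add: algebra_simps)
    then show "c *\<^sub>R x \<in> ?R"
      using R[OF locally_integrable_lincomb[OF *(2,2)] causal_lincomb[OF *(3,3)]] by (simp only:)
  qed
  moreover have "regular ` {g. locally_integrable g} \<union> {T. causal T} \<union> range impulse \<subseteq> ?R"
    using R0 R1 causal_impulse by blast
  ultimately have "real_functions \<subseteq> ?R"
    unfolding real_functions_def by (intro span_minimal)
  then show "f \<in> real_functions \<Longrightarrow> \<exists>g T. locally_integrable g \<and> causal T \<and> f = regular g + T"
    by blast
next
  assume "\<exists>g T. locally_integrable g \<and> causal T \<and> f = regular g + T"
  then obtain g T where *: "locally_integrable g" "causal T" "f = regular g + T" by blast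
  show "f \<in> real_functions"
    unfolding real_functions_def *(3) by (intro span_add span_base) (simp_all add: *(1,2))
qed

lemma causal_regular_integral_0:
  assumes g: "locally_integrable g" and c: "causal (regular g)" and \<phi>: "test_function \<phi>"
  shows "(LINT t|lborel. (1 - unit_step t) * (g t * \<phi> t)) = 0"
proof -
  obtain S :: "real \<Rightarrow> real" where S: "smooth S" "\<And>t. t \<le> 0 \<Longrightarrow> S t = 0" "\<And>t. 1 \<le> t \<Longrightarrow> S t = 1"
    "\<And>t. 0 \<le> S t" "\<And>t. S t \<le> 1"
    using smooth_step_exists by metis
  define cut where "cut = (\<lambda>n t. S (- real (Suc n) * t + -1))"
  have sm: "smooth (cut n)" for n unfolding cut_def by (rule smooth_affine[OF S(1)])
  have t: "test_function (\<lambda>t. \<phi> t * cut n t)" for n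
    by (rule test_function_mult[OF \<phi> sm])
  have z: "(LINT t|lborel. g t * (\<phi> t * cut n t)) = 0" for n
  proof -
    have "pairing (regular g) (\<lambda>t. \<phi> t * cut n t) = 0"
    proof (rule causalD[OF c t, of "- 1 / real (Suc n)"])
      fix t :: real assume "- 1 / real (Suc n) \<le> t"
      then have "- real (Suc n) * t + -1 \<le> 0" by (simp add: field_simps)
      then show "\<phi> t * cut n t = 0" by (simp add: cut_def S(2) del: of_nat_Suc)
    qed simp
    then show ?thesis by (simp add: pairing_regular g t)
  qed
  have lim: "(\<lambda>n. g t * (\<phi> t * cut n t)) \<longlonglongrightarrow> (1 - unit_step t) * (g t * \<phi> t)" for t
  proof (cases "t < 0")
    case True
    obtain m where m: "- 2 / t \<le> real m" using real_arch_simple by blast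
    have "cut n t = 1" if "n \<ge> m" for n
    proof -
      have "- 2 / t \<le> real (Suc n)" using m that by simp
      then have "1 \<le> - real (Suc n) * t + -1" using True by (simp add: field_simps del: of_nat_Suc)
      then show ?thesis by (simp add: cut_def S(3) del: of_nat_Suc)
    qed
    then show ?thesis using True
      by (intro tendsto_eventually eventually_sequentiallyI[of m]) (simp add: unit_step_def)
  next
    case False
    have "cut n t = 0" for n
    proof -
      have "0 \<le> real (Suc n) * t" using False by (intro mult_nonneg_nonneg) auto
      then show ?thesis by (simp add: cut_def S(2) del: of_nat_Suc)
    qed
    then show ?thesis using False by (simp add: unit_step_def)
  qed
  have "(\<lambda>n. LINT t|lborel. g t * (\<phi> t * cut n t)) \<longlonglongrightarrow> (LINT t|lborel. (1 - unit_step t) * (g t * \<phi> t))"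
  proof (rule integral_dominated_convergence[where w = "\<lambda>t. \<bar>g t * \<phi> t\<bar>"])
    have me: "(\<lambda>t. g t * \<phi> t) \<in> borel_measurable lborel"
      using integrable_times_test_function[OF g \<phi>] by (rule borel_measurable_integrable)
    show "(\<lambda>t. (1 - unit_step t) * (g t * \<phi> t)) \<in> borel_measurable lborel"
      using me unit_step_measurable by measurable
    show "(\<lambda>t. g t * (\<phi> t * cut n t)) \<in> borel_measurable lborel" for n
      using integrable_times_test_function[OF g t] by (rule borel_measurable_integrable)
    show "integrable lborel (\<lambda>t. \<bar>g t * \<phi> t\<bar>)"
      using integrable_times_test_function[OF g \<phi>] by (rule integrable_abs)
    show "AE t in lborel. (\<lambda>n. g t * (\<phi> t * cut n t)) \<longlonglongrightarrow> (1 - unit_step t) * (g t * \<phi> t)"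
      by (rule AE_I2) (rule lim)
    show "AE t in lborel. norm (g t * (\<phi> t * cut n t)) \<le> \<bar>g t * \<phi> t\<bar>" for n
    proof (rule AE_I2)
      fix t
      have "\<bar>g t * \<phi> t\<bar> * \<bar>cut n t\<bar> \<le> \<bar>g t * \<phi> t\<bar> * 1"
        using S(4,5) by (intro mult_left_mono) (auto simp: cut_def)
      then show "norm (g t * (\<phi> t * cut n t)) \<le> \<bar>g t * \<phi> t\<bar>" by (simp add: abs_mult mult.assoc)
    qed
  qed
  then show ?thesis by (simp add: z LIMSEQ_const_iff)
qed

lemma times_step_eq:
  assumes "locally_integrable g" "causal T"
  shows "times_step (regular g + T) = regular (\<lambda>t. unit_step t * g t) + T"
  unfolding times_step_def
proof (rule the_equality)
  show "\<exists>g' T'. locally_integrable g' \<and> causal T' \<and> regular g + T = regular g' + T' \<and>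
      regular (\<lambda>t. unit_step t * g t) + T = regular (\<lambda>t. unit_step t * g' t) + T'"
    using assms by blast
next
  fix h
  assume "\<exists>g' T'. locally_integrable g' \<and> causal T' \<and> regular g + T = regular g' + T' \<and>
      h = regular (\<lambda>t. unit_step t * g' t) + T'"
  then obtain g' T' where *: "locally_integrable g'" "causal T'" "regular g + T = regular g' + T'"
    "h = regular (\<lambda>t. unit_step t * g' t) + T'" by blast
  define d where "d = (\<lambda>t. 1 * g t + (-1) * g' t)"
  have d: "locally_integrable d"
    unfolding d_def by (rule locally_integrable_lincomb[OF assms(1) *(1)])
  have rd: "regular d = regular g - regular g'"
    unfolding d_def by (simp only: regular_lincomb[OF assms(1) *(1)]) simp
  also have "\<dots> = T' - T" using *(3) by (simp add: algebra_simps)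
  finally have rd': "regular d = T' - T" .
  then have "causal (regular d)" using causal_diff[OF *(2) assms(2)] by simp
  have "regular (\<lambda>t. unit_step t * d t) = regular d"
  proof (rule distribution_eqI)
    fix \<phi> :: "real \<Rightarrow> real" assume \<phi>: "test_function \<phi>"
    have "(LINT t|lborel. d t * \<phi> t) - (LINT t|lborel. unit_step t * d t * \<phi> t) =
        (LINT t|lborel. d t * \<phi> t - unit_step t * d t * \<phi> t)"
      by (intro Bochner_Integration.integral_diff[symmetric] integrable_times_test_function d \<phi>
          locally_integrable_unit_step)
    also have "\<dots> = (LINT t|lborel. (1 - unit_step t) * (d t * \<phi> t))"
      by (simp add: algebra_simps)
    finally show "pairing (regular (\<lambda>t. unit_step t * d t)) \<phi> = pairing (regular d) \<phi>"
      using causal_regular_integral_0[OF d \<open>causal (regular d)\<close> \<phi>]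
      by (simp add: pairing_regular d \<phi> locally_integrable_unit_step)
  qed
  moreover have "regular (\<lambda>t. unit_step t * d t) =
      regular (\<lambda>t. unit_step t * g t) - regular (\<lambda>t. unit_step t * g' t)"
  proof -
    have "(\<lambda>t. unit_step t * d t) = (\<lambda>t. 1 * (unit_step t * g t) + (-1) * (unit_step t * g' t))"
      by (simp add: d_def algebra_simps)
    then show ?thesis
      by (simp only: regular_lincomb[OF locally_integrable_unit_step[OF assms(1)]
            locally_integrable_unit_step[OF *(1)]]) simp
  qed
  ultimately have "regular (\<lambda>t. unit_step t * g t) - regular (\<lambda>t. unit_step t * g' t) = T' - T"
    using rd' by (simp only:)
  then show "h = regular (\<lambda>t. unit_step t * g t) + T"
    using *(4) by (simp add: algebra_simps)
qed

lemma times_step_causal: "causal T \<Longrightarrow> times_step T = T"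
proof -
  have "regular (\<lambda>t. 0) = 0"
    using regular_lincomb[OF locally_integrable_0 locally_integrable_0, of 0 0] by simp
  then show "causal T \<Longrightarrow> times_step T = T"
    using times_step_eq[OF locally_integrable_0, of T] by simp
qed

section \<open>The Laplace transform and its inverse\<close>

definition cpairing :: "distribution \<Rightarrow> (real \<Rightarrow> complex) \<Rightarrow> complex" where
  "cpairing T \<phi> = Complex (pairing T (\<lambda>t. Re (\<phi> t))) (pairing T (\<lambda>t. Im (\<phi> t)))"

text \<open>The integral of \<open>T\<close> times \<open>exp (- s * t)\<close> over the line for causal \<open>T\<close>: as \<open>exp (- s * t)\<close> has no
  compact support, it is cut off by \<open>\<kappa>(t / R)\<close> and \<open>R\<close> tends to infinity.  For locally integrable functions this
  extends the improper integral from \<open>0\<close> to infinity, see \<open>has_laplace_regular\<close>.\<close>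

definition has_bilateral_laplace :: "distribution \<Rightarrow> complex \<Rightarrow> complex \<Rightarrow> bool" where
  "has_bilateral_laplace T s z \<longleftrightarrow>
     (\<forall>\<kappa>. test_function \<kappa> \<longrightarrow> (\<forall>\<^sub>F t in nhds 0. \<kappa> t = 1) \<longrightarrow>
        ((\<lambda>R. cpairing T (\<lambda>t. \<kappa> (t / R) *\<^sub>R exp (- s * complex_of_real t))) \<longlongrightarrow> z) at_top)"

definition has_laplace :: "distribution \<Rightarrow> complex \<Rightarrow> complex \<Rightarrow> bool" where
  "has_laplace f s z \<longleftrightarrow> has_bilateral_laplace (times_step f) s z"

definition laplace :: "distribution \<Rightarrow> complex \<Rightarrow> complex" where
  "laplace f s = (THE z. has_laplace f s z)"

definition laplace_domain :: "distribution \<Rightarrow> complex set" where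
  "laplace_domain f = {s. 0 < Re s \<and> (\<exists>z. has_laplace f s z)}"

lemma has_laplace_unique:
  assumes "has_laplace f s z" "has_laplace f s w" shows "z = w"
proof -
  obtain \<kappa> where \<kappa>: "test_function \<kappa>" "\<forall>\<^sub>F t in nhds 0. \<kappa> t = 1" by (rule cutoff_exists)
  show ?thesis
  proof (rule tendsto_unique[OF trivial_limit_at_top_linorder])
    show "((\<lambda>R. cpairing (times_step f) (\<lambda>t. \<kappa> (t / R) *\<^sub>R exp (- s * complex_of_real t))) \<longlongrightarrow> z) at_top"
      using assms(1) \<kappa> unfolding has_laplace_def has_bilateral_laplace_def by simp
    show "((\<lambda>R. cpairing (times_step f) (\<lambda>t. \<kappa> (t / R) *\<^sub>R exp (- s * complex_of_real t))) \<longlongrightarrow> w) at_top"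
      using assms(2) \<kappa> unfolding has_laplace_def has_bilateral_laplace_def by simp
  qed
qed

lemma laplace_eqI: "has_laplace f s z \<Longrightarrow> laplace f s = z"
  unfolding laplace_def by (rule the_equality) (auto intro: has_laplace_unique)

lemma Re_damped_exp: "Re (c *\<^sub>R exp (- s * complex_of_real t)) = c * (exp (- Re s * t) * cos (Im s * t))"
  and Im_damped_exp: "Im (c *\<^sub>R exp (- s * complex_of_real t)) = c * (exp (- Re s * t) * - sin (Im s * t))"
  by (simp_all add: Re_exp Im_exp)

lemma test_function_damped_exp:
  assumes "test_function \<kappa>" "0 < R"
  shows "test_function (\<lambda>t. Re (\<kappa> (t / R) *\<^sub>R exp (- s * complex_of_real t)))"
    and "test_function (\<lambda>t. Im (\<kappa> (t / R) *\<^sub>R exp (- s * complex_of_real t)))"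
proof -
  have m: "smooth (\<lambda>t. - sin (Im s * t))"
    using smooth_cmult[OF smooth_sin, of "-1"] by simp
  show "test_function (\<lambda>t. Re (\<kappa> (t / R) *\<^sub>R exp (- s * complex_of_real t)))"
    unfolding Re_damped_exp
    by (intro test_function_mult[OF test_function_scale[OF assms]] smooth_mult smooth_exp smooth_cos)
  show "test_function (\<lambda>t. Im (\<kappa> (t / R) *\<^sub>R exp (- s * complex_of_real t)))"
    unfolding Im_damped_exp
    by (intro test_function_mult[OF test_function_scale[OF assms]] smooth_mult smooth_exp m)
qed

lemma has_laplace_delta: "has_laplace delta s 1"
  unfolding has_laplace_def has_bilateral_laplace_def
proof (intro allI impI)
  fix \<kappa> :: "real \<Rightarrow> real" assume \<kappa>: "test_function \<kappa>" "\<forall>\<^sub>F t in nhds 0. \<kappa> t = 1"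
  have "causal delta" using causal_impulse[of 0] by (simp add: impulse_def)
  then have "times_step delta = delta" by (rule times_step_causal)
  have "\<kappa> 0 = 1" using eventually_nhds_x_imp_x[OF \<kappa>(2)] .
  then have "cpairing (times_step delta) (\<lambda>t. \<kappa> (t / R) *\<^sub>R exp (- s * complex_of_real t)) = 1"
    if "0 < R" for R
    using test_function_damped_exp[OF \<kappa>(1) that, of s]
    unfolding cpairing_def by (simp only: \<open>times_step delta = delta\<close> pairing_delta) (simp add: complex_eq_iff)
  then have "\<forall>\<^sub>F R in at_top.
      cpairing (times_step delta) (\<lambda>t. \<kappa> (t / R) *\<^sub>R exp (- s * complex_of_real t)) = 1"
    by (rule eventually_mono[OF eventually_gt_at_top[of 0]])
  then show "((\<lambda>R. cpairing (times_step delta) (\<lambda>t. \<kappa> (t / R) *\<^sub>R exp (- s * complex_of_real t))) \<longlongrightarrow> 1) at_top"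
    by (rule tendsto_eventually)
qed

lemma cutoff_integral_tendsto:
  fixes h :: "real \<Rightarrow> complex"
  assumes h [measurable]: "h \<in> borel_measurable borel" and h0: "\<And>t. t < 0 \<Longrightarrow> h t = 0"
    and int: "\<And>R. integrable lborel (\<lambda>t. indicat_real {0..R} t *\<^sub>R h t)"
    and lim: "((\<lambda>R. LINT t|lborel. indicat_real {0..R} t *\<^sub>R h t) \<longlongrightarrow> z) at_top"
    and \<kappa>: "test_function \<kappa>" "\<kappa> 0 = 1"
  shows "((\<lambda>R. LINT t|lborel. \<kappa> (t / R) *\<^sub>R h t) \<longlongrightarrow> z) at_top"
proof -
  obtain K0 where K0: "\<And>t. K0 < \<bar>t\<bar> \<Longrightarrow> \<kappa> t = 0" using \<kappa>(1) unfolding test_function_def by blast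
  define K where "K = \<bar>K0\<bar> + 1"
  have K: "K > 0" "\<And>t. K \<le> t \<Longrightarrow> \<kappa> t = 0" unfolding K_def using K0 by auto
  note sm = test_function_smooth[OF \<kappa>(1)]
  have cont: "continuous_on A (deriv \<kappa>)" for A by (intro smooth_continuous smooth_deriv sm)
  have [measurable]: "deriv \<kappa> \<in> borel_measurable borel"
    using cont by (rule borel_measurable_continuous_onI)
  have ftc: "(LINT x|lborel. indicat_real {a..K} x *\<^sub>R - deriv \<kappa> x) = \<kappa> a" if "a \<le> K" for a
  proof -
    have "(LINT x|lborel. indicat_real {a..K} x *\<^sub>R - deriv \<kappa> x) = (- \<kappa> K) - (- \<kappa> a)"
    proof (rule integral_FTC_atLeastAtMost[OF that])
      show "((\<lambda>x. - \<kappa> x) has_vector_derivative - deriv \<kappa> x) (at x within {a..K})" for x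
        using DERIV_minus[OF smooth_has_deriv[OF sm]]
        by (simp add: has_real_derivative_iff_has_vector_derivative has_vector_derivative_at_within)
      show "continuous_on {a..K} (\<lambda>x. - deriv \<kappa> x)" by (intro continuous_intros cont)
    qed
    then show ?thesis using K by simp
  qed
  have ki: "integrable lborel (\<lambda>x. indicat_real {a..K} x *\<^sub>R - deriv \<kappa> x)" for a
    using borel_integrable_atLeastAtMost'[of a K "\<lambda>x. - deriv \<kappa> x"] continuous_on_minus[OF cont]
    by (simp add: set_integrable_def)
  have "compact (deriv \<kappa> ` {0..K})" by (intro compact_continuous_image cont) simp
  then have "bounded (deriv \<kappa> ` {0..K})" by (rule compact_imp_bounded)
  then obtain M where "\<forall>x\<in>deriv \<kappa> ` {0..K}. norm x \<le> M" unfolding bounded_iff by blast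
  then have M: "\<bar>deriv \<kappa> x\<bar> \<le> M" if "0 \<le> x" "x \<le> K" for x using that by simp
  have M0: "0 \<le> M" using M[of 0] K(1) by simp
  define G where "G = (\<lambda>x. LINT t|lborel. indicat_real {0..x} t *\<^sub>R h t)"
  define F where "F = (\<lambda>R x t. (indicat_real {0..K} x * - deriv \<kappa> x) *\<^sub>R (if t \<le> R * x then h t else 0))"
  have hpos: "(if t \<le> y then h t else 0) = indicat_real {0..y} t *\<^sub>R h t" for t y
    using h0[of t] by (auto simp: indicator_def)
  have Fm: "(\<lambda>(x, t). F R x t) \<in> borel_measurable (lborel \<Otimes>\<^sub>M lborel)" for R
    unfolding F_def by measurable
  have Gm [measurable]: "(\<lambda>x. G (R * x)) \<in> borel_measurable borel" for R
  proof -
    have "(\<lambda>x. LINT t|lborel. (if t \<le> R * x then h t else 0)) \<in> borel_measurable lborel"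
      by measurable
    then show ?thesis by (simp add: G_def hpos)
  qed
  have Fin: "integrable lborel (F R x)" for R x
    unfolding F_def hpos by (intro integrable_scaleR_right int)
  have nF: "norm (F R x t) \<le> (indicat_real {0..K} x * M) * norm (indicat_real {0..R * K} t *\<^sub>R h t)"
    if "0 < R" for R x t
  proof (cases "x \<in> {0..K} \<and> 0 \<le> t \<and> t \<le> R * x")
    case True
    then have "R * x \<le> R * K" using that by simp
    then show ?thesis using True M[of x] by (simp add: F_def mult_right_mono)
  next
    case False
    then have "F R x t = 0" using h0[of t] by (auto simp: F_def indicator_def)
    then show ?thesis using M0 by simp
  qed
  have Fint: "integrable (lborel \<Otimes>\<^sub>M lborel) (\<lambda>(x, t). F R x t)" if R: "0 < R" for R
  proof (rule lborel_pair.Fubini_integrable[OF Fm])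
    define B where "B = (LINT t|lborel. norm (indicat_real {0..R * K} t *\<^sub>R h t))"
    have "integrable lborel (\<lambda>x. LINT t|lborel. norm (F R x t))"
    proof (rule Bochner_Integration.integrable_bound)
      show "integrable lborel (\<lambda>x. indicat_real {0..K} x * (M * B))"
        by (intro integrable_mult_left integrable_real_indicator) (simp_all add: emeasure_lborel_Icc_eq)
      show "(\<lambda>x. LINT t|lborel. norm (F R x t)) \<in> borel_measurable lborel"
        unfolding F_def by measurable
      show "AE x in lborel. norm (LINT t|lborel. norm (F R x t)) \<le> norm (indicat_real {0..K} x * (M * B))"
      proof (rule AE_I2)
        fix x
        have "(LINT t|lborel. norm (F R x t)) \<le>
            (LINT t|lborel. (indicat_real {0..K} x * M) * norm (indicat_real {0..R * K} t *\<^sub>R h t))"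
          by (intro integral_mono integrable_norm Fin integrable_mult_right int nF R)
        also have "\<dots> = indicat_real {0..K} x * (M * B)" by (simp add: B_def)
        finally have "(LINT t|lborel. norm (F R x t)) \<le> indicat_real {0..K} x * (M * B)" .
        moreover have "0 \<le> (LINT t|lborel. norm (F R x t))" by (rule Bochner_Integration.integral_nonneg) simp
        ultimately show "norm (LINT t|lborel. norm (F R x t)) \<le> norm (indicat_real {0..K} x * (M * B))"
          by simp
      qed
    qed
    then show "integrable lborel (\<lambda>x. LINT t|lborel. norm (case (x, t) of (x, t) \<Rightarrow> F R x t))" by simp
    show "AE x in lborel. integrable lborel (\<lambda>t. case (x, t) of (x, t) \<Rightarrow> F R x t)"
      using Fin by simp
  qed
  have key: "(LINT t|lborel. \<kappa> (t / R) *\<^sub>R h t) =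
      (LINT x|lborel. (indicat_real {0..K} x * - deriv \<kappa> x) *\<^sub>R G (R * x))" if R: "0 < R" for R
  proof -
    have "(LINT x|lborel. F R x t) = \<kappa> (t / R) *\<^sub>R h t" for t
    proof (cases "t < 0")
      case True
      then have "F R x t = 0" for x by (simp add: F_def h0)
      then show ?thesis using True by (simp add: h0)
    next
      case False
      have "F R x t = (indicat_real {t / R..K} x *\<^sub>R - deriv \<kappa> x) *\<^sub>R h t" for x
      proof -
        have "0 \<le> x" if "t / R \<le> x"
        proof -
          have "0 \<le> t / R" using False R by simp
          then show ?thesis using that by linarith
        qed
        moreover have "t \<le> R * x \<longleftrightarrow> t / R \<le> x" using R by (simp add: field_simps)
        ultimately show ?thesis by (auto simp: F_def indicator_def)
      qed
      then have "(LINT x|lborel. F R x t) =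
          (LINT x|lborel. (indicat_real {t / R..K} x *\<^sub>R - deriv \<kappa> x) *\<^sub>R h t)" by simp
      also have "\<dots> = (LINT x|lborel. indicat_real {t / R..K} x *\<^sub>R - deriv \<kappa> x) *\<^sub>R h t"
        by (rule integral_scaleR_left) (rule ki)
      also have "(LINT x|lborel. indicat_real {t / R..K} x *\<^sub>R - deriv \<kappa> x) = \<kappa> (t / R)"
        using ftc[of "t / R"] K(2)[of "t / R"] by (cases "t / R \<le> K") simp_all
      finally show ?thesis .
    qed
    then have "(LINT t|lborel. \<kappa> (t / R) *\<^sub>R h t) = (LINT t|lborel. LINT x|lborel. F R x t)" by simp
    also have "\<dots> = (LINT x|lborel. LINT t|lborel. F R x t)"
      by (rule lborel_pair.Fubini_integral[OF Fint[OF R]])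
    also have "(\<lambda>x. LINT t|lborel. F R x t) = (\<lambda>x. (indicat_real {0..K} x * - deriv \<kappa> x) *\<^sub>R G (R * x))"
      unfolding F_def hpos G_def by (rule ext) (rule integral_scaleR_right)
    finally show ?thesis .
  qed
  obtain X where X: "\<And>x. X \<le> x \<Longrightarrow> norm (G x) \<le> norm z + 1"
  proof -
    have "\<forall>\<^sub>F x in at_top. dist (G x) z < 1" using lim unfolding G_def by (rule tendstoD) simp
    then obtain X where X: "\<And>x. X \<le> x \<Longrightarrow> dist (G x) z < 1" unfolding eventually_at_top_linorder by blast
    have "norm (G x) \<le> norm z + 1" if "X \<le> x" for x
      using X[OF that] norm_triangle_sub[of "G x" z] by (simp add: dist_norm)
    then show thesis by (rule that)
  qed
  define B where "B = norm z + 1 + (LINT t|lborel. norm (indicat_real {0..X} t *\<^sub>R h t))"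
  have GB: "norm (G x) \<le> B" for x
  proof (cases "X \<le> x")
    case True
    have "0 \<le> (LINT t|lborel. norm (indicat_real {0..X} t *\<^sub>R h t))" by (rule Bochner_Integration.integral_nonneg) simp
    then show ?thesis unfolding B_def using X[OF True] by linarith
  next
    case False
    have "norm (G x) \<le> (LINT t|lborel. norm (indicat_real {0..x} t *\<^sub>R h t))"
      unfolding G_def by (rule integral_norm_bound)
    also have "\<dots> \<le> (LINT t|lborel. norm (indicat_real {0..X} t *\<^sub>R h t))"
      using False by (intro integral_mono integrable_norm int) (simp add: indicator_def)
    finally show ?thesis unfolding B_def using norm_ge_zero[of z] by linarith
  qed
  have "((\<lambda>R. LINT x|lborel. (indicat_real {0..K} x * - deriv \<kappa> x) *\<^sub>R G (R * x)) \<longlongrightarrow>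
      (LINT x|lborel. (indicat_real {0..K} x * - deriv \<kappa> x) *\<^sub>R z)) at_top"
  proof (rule integral_dominated_convergence_at_top[where w = "\<lambda>x. indicat_real {0..K} x * (M * B)"])
    show "\<forall>\<^sub>F R in at_top. AE x in lborel. norm ((indicat_real {0..K} x * - deriv \<kappa> x) *\<^sub>R G (R * x))
        \<le> indicat_real {0..K} x * (M * B)"
    proof (intro always_eventually allI AE_I2)
      fix R x show "norm ((indicat_real {0..K} x * - deriv \<kappa> x) *\<^sub>R G (R * x)) \<le> indicat_real {0..K} x * (M * B)"
        using M[of x] GB[of "R * x"] M0 by (auto simp: indicator_def intro: mult_mono)
    qed
    show "AE x in lborel. ((\<lambda>R. (indicat_real {0..K} x * - deriv \<kappa> x) *\<^sub>R G (R * x)) \<longlongrightarrow>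
        (indicat_real {0..K} x * - deriv \<kappa> x) *\<^sub>R z) at_top"
      using AE_lborel_singleton[of 0]
    proof eventually_elim
      case (elim x)
      show ?case
      proof (cases "0 < x")
        case True
        have "filterlim (\<lambda>R. R * x) at_top at_top"
          using True by (intro filterlim_at_top_mult_tendsto_pos[OF tendsto_const _ filterlim_ident])
        then have "((\<lambda>R. G (R * x)) \<longlongrightarrow> z) at_top"
          unfolding G_def by (rule filterlim_compose[OF lim])
        then show ?thesis by (intro tendsto_intros)
      next
        case False
        then show ?thesis using elim by simp
      qed
    qed
    show "(\<lambda>x. (indicat_real {0..K} x * - deriv \<kappa> x) *\<^sub>R G (R * x)) \<in> borel_measurable lborel" for R
      by measurable
    show "(\<lambda>x. (indicat_real {0..K} x * - deriv \<kappa> x) *\<^sub>R z) \<in> borel_measurable lborel"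
      by measurable
    show "integrable lborel (\<lambda>x. indicat_real {0..K} x * (M * B))"
        by (intro integrable_mult_left integrable_real_indicator) (simp_all add: emeasure_lborel_Icc_eq)
  qed
  moreover have "(LINT x|lborel. (indicat_real {0..K} x * - deriv \<kappa> x) *\<^sub>R z) = z"
  proof -
    have "(LINT x|lborel. (indicat_real {0..K} x *\<^sub>R - deriv \<kappa> x) *\<^sub>R z) =
        (LINT x|lborel. indicat_real {0..K} x *\<^sub>R - deriv \<kappa> x) *\<^sub>R z"
      by (rule integral_scaleR_left) (rule ki)
    then show ?thesis using ftc[of 0] K(1) \<kappa>(2) by simp
  qed
  ultimately have "((\<lambda>R. LINT x|lborel. (indicat_real {0..K} x * - deriv \<kappa> x) *\<^sub>R G (R * x)) \<longlongrightarrow> z) at_top"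
    by simp
  then show ?thesis
  proof (rule Lim_transform_eventually)
    show "\<forall>\<^sub>F R in at_top. (LINT x|lborel. (indicat_real {0..K} x * - deriv \<kappa> x) *\<^sub>R G (R * x)) =
        (LINT t|lborel. \<kappa> (t / R) *\<^sub>R h t)"
      using eventually_gt_at_top[of 0] by eventually_elim (simp add: key)
  qed
qed


lemma cpairing_regular:
  fixes \<phi> :: "real \<Rightarrow> complex"
  assumes g: "locally_integrable g" and cont: "continuous_on UNIV \<phi>" and K: "\<And>t. K < \<bar>t\<bar> \<Longrightarrow> \<phi> t = 0"
    and t: "test_function (\<lambda>t. Re (\<phi> t))" "test_function (\<lambda>t. Im (\<phi> t))"
  shows "cpairing (regular g) \<phi> = (LINT t|lborel. g t *\<^sub>R \<phi> t)"
proof -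
  have i: "integrable lborel (\<lambda>t. g t *\<^sub>R \<phi> t)"
    by (rule integrable_locally_integrable_times[OF g cont K])
  show ?thesis
    unfolding cpairing_def pairing_regular[OF g t(1)] pairing_regular[OF g t(2)]
    using integral_Re[OF i] integral_Im[OF i] by (simp add: complex_eq_iff)
qed

lemma has_laplace_regular:
  assumes g: "locally_integrable g"
    and lim: "((\<lambda>R. LINT t:{0..R}|lborel. g t *\<^sub>R exp (- s * complex_of_real t)) \<longlongrightarrow> z) at_top"
  shows "has_laplace (regular g) s z"
proof -
  define h where "h = (\<lambda>t. (unit_step t * g t) *\<^sub>R exp (- s * complex_of_real t))"
  have gu: "locally_integrable (\<lambda>t. unit_step t * g t)" by (rule locally_integrable_unit_step[OF g])
  have step: "times_step (regular g) = regular (\<lambda>t. unit_step t * g t)"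
    using times_step_eq[OF g causal_0] by simp
  have hi: "indicat_real {0..R} t *\<^sub>R h t = indicat_real {0..R} t *\<^sub>R (g t *\<^sub>R exp (- s * complex_of_real t))" for R t
    by (auto simp: h_def unit_step_def indicator_def)
  have [measurable]: "g \<in> borel_measurable borel" by (rule locally_integrable_measurable[OF g])
  have e [measurable]: "(\<lambda>t. exp (- s * complex_of_real t)) \<in> borel_measurable borel"
    by (intro borel_measurable_continuous_onI continuous_intros)
  note unit_step_measurable [measurable]
  have hm: "h \<in> borel_measurable borel" unfolding h_def by measurable
  have int: "integrable lborel (\<lambda>t. indicat_real {0..R} t *\<^sub>R h t)" for R
  proof (rule Bochner_Integration.integrable_bound)
    show "integrable lborel (\<lambda>t. exp (\<bar>Re s\<bar> * \<bar>R\<bar>) * (indicat_real {0..R} t * g t))"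
      by (intro integrable_mult_right locally_integrableD[OF g])
    show "(\<lambda>t. indicat_real {0..R} t *\<^sub>R h t) \<in> borel_measurable lborel"
      using hm by measurable
    show "AE t in lborel. norm (indicat_real {0..R} t *\<^sub>R h t)
        \<le> norm (exp (\<bar>Re s\<bar> * \<bar>R\<bar>) * (indicat_real {0..R} t * g t))"
    proof (rule AE_I2)
      fix t
      show "norm (indicat_real {0..R} t *\<^sub>R h t) \<le> norm (exp (\<bar>Re s\<bar> * \<bar>R\<bar>) * (indicat_real {0..R} t * g t))"
      proof (cases "t \<in> {0..R}")
        case True
        have "- Re s * t \<le> \<bar>Re s\<bar> * t" using True by (intro mult_right_mono) auto
        also have "\<dots> \<le> \<bar>Re s\<bar> * \<bar>R\<bar>" using True by (intro mult_left_mono) auto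
        finally have "exp (- Re s * t) * \<bar>g t\<bar> \<le> exp (\<bar>Re s\<bar> * \<bar>R\<bar>) * \<bar>g t\<bar>"
          by (intro mult_right_mono) simp_all
        moreover have "norm (h t) = exp (- Re s * t) * \<bar>g t\<bar>"
          using True by (simp add: h_def unit_step_def abs_mult mult.commute)
        ultimately show ?thesis using True by (simp add: abs_mult)
      qed simp
    qed
  qed
  have "((\<lambda>R. LINT t|lborel. indicat_real {0..R} t *\<^sub>R h t) \<longlongrightarrow> z) at_top"
    using lim by (simp only: hi set_lebesgue_integral_def)
  note cutoff = cutoff_integral_tendsto[OF hm _ int this]
  show ?thesis
    unfolding has_laplace_def has_bilateral_laplace_def step
  proof (intro allI impI)
    fix \<kappa> :: "real \<Rightarrow> real" assume \<kappa>: "test_function \<kappa>" "\<forall>\<^sub>F t in nhds 0. \<kappa> t = 1"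
    obtain K where K: "\<And>t. K < \<bar>t\<bar> \<Longrightarrow> \<kappa> t = 0" using \<kappa>(1) unfolding test_function_def by blast
    have "((\<lambda>R. LINT t|lborel. \<kappa> (t / R) *\<^sub>R h t) \<longlongrightarrow> z) at_top"
      by (rule cutoff[OF _ \<kappa>(1) eventually_nhds_x_imp_x[OF \<kappa>(2)]]) (simp add: h_def unit_step_def)
    then show "((\<lambda>R. cpairing (regular (\<lambda>t. unit_step t * g t))
        (\<lambda>t. \<kappa> (t / R) *\<^sub>R exp (- s * complex_of_real t))) \<longlongrightarrow> z) at_top"
    proof (rule Lim_transform_eventually)
      have "(LINT t|lborel. \<kappa> (t / R) *\<^sub>R h t) = cpairing (regular (\<lambda>t. unit_step t * g t))
          (\<lambda>t. \<kappa> (t / R) *\<^sub>R exp (- s * complex_of_real t))" if R: "0 < R" for R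
      proof -
        have "cpairing (regular (\<lambda>t. unit_step t * g t)) (\<lambda>t. \<kappa> (t / R) *\<^sub>R exp (- s * complex_of_real t)) =
            (LINT t|lborel. (unit_step t * g t) *\<^sub>R (\<kappa> (t / R) *\<^sub>R exp (- s * complex_of_real t)))"
        proof (rule cpairing_regular[OF gu _ _ test_function_damped_exp[OF \<kappa>(1) R]])
          show "continuous_on UNIV (\<lambda>t. \<kappa> (t / R) *\<^sub>R exp (- s * complex_of_real t))"
            by (intro continuous_intros smooth_continuous test_function_smooth test_function_scale \<kappa>(1) R)
          show "\<kappa> (t / R) *\<^sub>R exp (- s * complex_of_real t) = 0" if "K * R < \<bar>t\<bar>" for t
            using K[of "t / R"] that R by (simp add: field_simps)
        qed
        then show ?thesis by (simp add: h_def mult.commute)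
      qed
      then show "\<forall>\<^sub>F R in at_top. (LINT t|lborel. \<kappa> (t / R) *\<^sub>R h t) =
          cpairing (regular (\<lambda>t. unit_step t * g t)) (\<lambda>t. \<kappa> (t / R) *\<^sub>R exp (- s * complex_of_real t))"
        by (rule eventually_mono[OF eventually_gt_at_top[of 0]])
    qed
  qed
qed

text \<open>Since the inverse transform of \<open>s ^ n\<close> is an impulse function, the inversion integral over the
  line \<open>Re s = \<sigma>\<close> is taken as a limit of distributions.\<close>

definition inversion_integral :: "(complex \<Rightarrow> complex) \<Rightarrow> real \<Rightarrow> real \<Rightarrow> real \<Rightarrow> complex" where
  "inversion_integral F \<sigma> W t =
     1 / (2 * of_real pi * \<i>) *
     contour_integral (linepath (Complex \<sigma> (- W)) (Complex \<sigma> W)) (\<lambda>s. F s * exp (s * complex_of_real t))"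

definition has_inverse_laplace :: "(complex \<Rightarrow> complex) \<Rightarrow> real \<Rightarrow> distribution \<Rightarrow> bool" where
  "has_inverse_laplace F \<sigma> g \<longleftrightarrow>
     (\<forall>W>0. \<forall>t. (\<lambda>s. F s * exp (s * complex_of_real t)) contour_integrable_on
        linepath (Complex \<sigma> (- W)) (Complex \<sigma> W)) \<and>
     (\<forall>\<phi>. test_function \<phi> \<longrightarrow>
        ((\<lambda>W. LINT t|lborel. \<phi> t *\<^sub>R inversion_integral F \<sigma> W t) \<longlongrightarrow> of_real (pairing g \<phi>)) at_top)"

end

theory Submission
  imports Defs
begin

text \<open>One differentiation multiplies the transform by \<open>s\<close>; the theorem iterates this.  Moving the
  derivative onto the damped cutoff \<open>\<kappa>(t / R) exp (- s t)\<close> gives \<open>s\<close> times the same damped cutoff,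
  which produces \<open>s\<close> times the transform in the limit, and a remainder
  \<open>- \<kappa>'(t / R) exp (- s t) / R\<close>.  A general distribution offers no growth estimate at infinity from
  which the remainder could be bounded.  Instead, the transform is by definition the same limit for
  every cutoff, that is, for every test function equal to \<open>1\<close> near \<open>0\<close>, and \<open>\<kappa> + \<kappa>'\<close> is again a cutoff because \<open>\<kappa>'\<close> vanishes near \<open>0\<close>.  Subtracting the
  limits for \<open>\<kappa> + \<kappa>'\<close> and for \<open>\<kappa>\<close> shows that the pairing with \<open>\<kappa>'(t / R) exp (- s t)\<close> tends to
  \<open>0\<close>, so the remainder vanishes (\<open>has_bilateral_laplace_deriv\<close>).

  Since \<open>times_step f\<close> and all its derivatives are causal, multiplication by the step function does
  not change them, and no terms with initial values at \<open>0\<close> appear.\<close>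

lemma cpairing_add:
  assumes "test_function (\<lambda>t. Re (\<phi> t))" "test_function (\<lambda>t. Im (\<phi> t))"
    and "test_function (\<lambda>t. Re (\<psi> t))" "test_function (\<lambda>t. Im (\<psi> t))"
  shows "cpairing T (\<lambda>t. \<phi> t + \<psi> t) = cpairing T \<phi> + cpairing T \<psi>"
  using pairing_lincomb[OF assms(1,3), of T 1 1] pairing_lincomb[OF assms(2,4), of T 1 1]
  by (simp add: cpairing_def complex_eq_iff)

lemma cpairing_cmult:
  assumes "test_function (\<lambda>t. Re (\<phi> t))" "test_function (\<lambda>t. Im (\<phi> t))"
  shows "cpairing T (\<lambda>t. c * \<phi> t) = c * cpairing T \<phi>"
  using pairing_lincomb[OF assms, of T "Re c" "- Im c"] pairing_lincomb[OF assms, of T "Im c" "Re c"]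
  by (simp add: cpairing_def complex_eq_iff algebra_simps)

lemma test_function_Re_Im_cmult:
  assumes "test_function (\<lambda>t. Re (\<phi> t))" "test_function (\<lambda>t. Im (\<phi> t))"
  shows "test_function (\<lambda>t. Re (c * \<phi> t))" "test_function (\<lambda>t. Im (c * \<phi> t))"
  using test_function_lincomb[OF assms, of "Re c" "- Im c"] test_function_lincomb[OF assms, of "Im c" "Re c"]
  by (simp_all add: algebra_simps)

lemma cpairing_dist_deriv:
  assumes "test_function (\<lambda>t. Re (\<phi> t))" "test_function (\<lambda>t. Im (\<phi> t))"
    and d: "\<And>t. (\<phi> has_vector_derivative \<phi>' t) (at t)"
  shows "cpairing (dist_deriv T) \<phi> = - cpairing T \<phi>'"
proof -
  have "deriv (\<lambda>t. Re (\<phi> t)) = (\<lambda>t. Re (\<phi>' t))" "deriv (\<lambda>t. Im (\<phi> t)) = (\<lambda>t. Im (\<phi>' t))"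
    using has_field_derivative_Re[OF d] has_field_derivative_Im[OF d]
    by (auto intro!: ext DERIV_imp_deriv)
  then show ?thesis
    using assms(1,2) by (simp add: cpairing_def pairing_deriv complex_eq_iff)
qed

lemma deriv_cutoff_eventually_0:
  fixes \<kappa> :: "real \<Rightarrow> real"
  assumes "\<forall>\<^sub>F t in nhds 0. \<kappa> t = 1"
  shows "\<forall>\<^sub>F t in nhds 0. deriv \<kappa> t = 0"
proof -
  have "\<forall>\<^sub>F t in nhds 0. \<forall>\<^sub>F t in nhds t. \<kappa> t = 1"
    by (rule eventually_eventually[THEN iffD2, OF assms])
  then show ?thesis
  proof eventually_elim
    case (elim t)
    then have "deriv \<kappa> t = deriv (\<lambda>_. 1) t" by (intro deriv_cong_ev) auto
    then show ?case by simp
  qed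
qed

lemma damped_cutoff_has_vector_derivative:
  assumes "smooth \<kappa>"
  shows "((\<lambda>t. \<kappa> (t / R) *\<^sub>R exp (- s * complex_of_real t)) has_vector_derivative
     of_real (1 / R) * (deriv \<kappa> (t / R) *\<^sub>R exp (- s * complex_of_real t)) +
     - s * (\<kappa> (t / R) *\<^sub>R exp (- s * complex_of_real t))) (at t)"
proof -
  have "((\<lambda>t. t / R) has_real_derivative 1 / R) (at t)"
    by (rule DERIV_cdivide[OF DERIV_ident])
  then have k: "((\<lambda>t. \<kappa> (t / R)) has_real_derivative deriv \<kappa> (t / R) * (1 / R)) (at t)"
    by (rule DERIV_chain2[OF smooth_has_deriv[OF assms]])
  have "((\<lambda>z. exp (- s * z)) has_field_derivative - s * exp (- s * of_real t)) (at (of_real t))"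
    by (auto intro!: derivative_eq_intros)
  then have e: "((\<lambda>t. exp (- s * complex_of_real t)) has_vector_derivative
      - s * exp (- s * complex_of_real t)) (at t)"
    by (rule has_vector_derivative_real_field)
  show ?thesis
    by (rule has_vector_derivative_eq_rhs[OF has_vector_derivative_scaleR[OF k e]])
       (simp add: scaleR_conv_of_real algebra_simps)
qed

text \<open>Independence of the limit from the cutoff forces the pairing with any \<open>\<eta>\<close> that vanishes near
  \<open>0\<close> to tend to \<open>0\<close>: both \<open>\<kappa>\<close> and \<open>\<kappa> + \<eta>\<close> are cutoffs.\<close>

lemma has_bilateral_laplace_cutoff_diff:
  assumes T: "has_bilateral_laplace T s z"
    and \<eta>: "test_function \<eta>" "\<forall>\<^sub>F t in nhds 0. \<eta> t = 0"
  shows "((\<lambda>R. cpairing T (\<lambda>t. \<eta> (t / R) *\<^sub>R exp (- s * complex_of_real t))) \<longlongrightarrow> 0) at_top"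
proof -
  let ?E = "\<lambda>\<kappa> R t. \<kappa> (t / R) *\<^sub>R exp (- s * complex_of_real t)"
  obtain \<kappa> where \<kappa>: "test_function \<kappa>" "\<forall>\<^sub>F t in nhds 0. \<kappa> t = 1" by (rule cutoff_exists)
  let ?k = "\<lambda>t. \<kappa> t + \<eta> t"
  have k: "test_function ?k" using test_function_lincomb[OF \<kappa>(1) \<eta>(1), of 1 1] by simp
  have k1: "\<forall>\<^sub>F t in nhds 0. ?k t = 1" using \<kappa>(2) \<eta>(2) by eventually_elim simp
  have "((\<lambda>R. cpairing T (?E ?k R)) \<longlongrightarrow> z) at_top" "((\<lambda>R. cpairing T (?E \<kappa> R)) \<longlongrightarrow> z) at_top"
    using T k k1 \<kappa> unfolding has_bilateral_laplace_def by blast+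
  from tendsto_diff[OF this]
  have "((\<lambda>R. cpairing T (?E ?k R) - cpairing T (?E \<kappa> R)) \<longlongrightarrow> 0) at_top" by simp
  then show ?thesis
  proof (rule Lim_transform_eventually)
    have "cpairing T (?E ?k R) - cpairing T (?E \<kappa> R) = cpairing T (?E \<eta> R)" if "0 < R" for R
      using cpairing_add[OF test_function_damped_exp[OF \<kappa>(1) that, of s]
          test_function_damped_exp[OF \<eta>(1) that, of s], of T]
      by (simp add: scaleR_add_left)
    then show "\<forall>\<^sub>F R in at_top. cpairing T (?E ?k R) - cpairing T (?E \<kappa> R) = cpairing T (?E \<eta> R)"
      by (rule eventually_mono[OF eventually_gt_at_top[of 0]])
  qed
qed

lemma has_bilateral_laplace_deriv:
  assumes T: "has_bilateral_laplace T s z"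
  shows "has_bilateral_laplace (dist_deriv T) s (s * z)"
  unfolding has_bilateral_laplace_def
proof (intro allI impI)
  fix \<kappa> :: "real \<Rightarrow> real" assume \<kappa>: "test_function \<kappa>" "\<forall>\<^sub>F t in nhds 0. \<kappa> t = 1"
  let ?E = "\<lambda>\<kappa> R t. \<kappa> (t / R) *\<^sub>R exp (- s * complex_of_real t)"
  have key: "s * cpairing T (?E \<kappa> R) - of_real (1 / R) * cpairing T (?E (deriv \<kappa>) R)
      = cpairing (dist_deriv T) (?E \<kappa> R)" if R: "0 < R" for R
  proof -
    note t = test_function_damped_exp[OF \<kappa>(1) R, of s]
    note t' = test_function_damped_exp[OF test_function_deriv[OF \<kappa>(1)] R, of s]
    have "cpairing (dist_deriv T) (?E \<kappa> R) =
        - cpairing T (\<lambda>t. of_real (1 / R) * ?E (deriv \<kappa>) R t + - s * ?E \<kappa> R t)"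
      by (rule cpairing_dist_deriv[OF t
            damped_cutoff_has_vector_derivative[OF test_function_smooth[OF \<kappa>(1)]]])
    also have "\<dots> = - (of_real (1 / R) * cpairing T (?E (deriv \<kappa>) R) + - s * cpairing T (?E \<kappa> R))"
      by (simp only: cpairing_add[OF test_function_Re_Im_cmult[OF t'] test_function_Re_Im_cmult[OF t]]
          cpairing_cmult[OF t'] cpairing_cmult[OF t])
    finally show ?thesis by simp
  qed
  have "((\<lambda>R. cpairing T (?E \<kappa> R)) \<longlongrightarrow> z) at_top"
    using T \<kappa> unfolding has_bilateral_laplace_def by blast
  moreover have "((\<lambda>R. cpairing T (?E (deriv \<kappa>) R)) \<longlongrightarrow> 0) at_top"
    by (rule has_bilateral_laplace_cutoff_diff[OF T test_function_deriv[OF \<kappa>(1)]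
          deriv_cutoff_eventually_0[OF \<kappa>(2)]])
  moreover have "((\<lambda>R. complex_of_real (1 / R)) \<longlongrightarrow> of_real 0) at_top"
    by (intro tendsto_of_real tendsto_divide_0[OF tendsto_const]
        filterlim_at_top_imp_at_infinity filterlim_ident)
  ultimately have "((\<lambda>R. s * cpairing T (?E \<kappa> R) - of_real (1 / R) * cpairing T (?E (deriv \<kappa>) R))
      \<longlongrightarrow> s * z - of_real 0 * 0) at_top"
    by (intro tendsto_diff tendsto_mult tendsto_const)
  then have "((\<lambda>R. s * cpairing T (?E \<kappa> R) - of_real (1 / R) * cpairing T (?E (deriv \<kappa>) R))
      \<longlongrightarrow> s * z) at_top" by simp
  then show "((\<lambda>R. cpairing (dist_deriv T) (?E \<kappa> R)) \<longlongrightarrow> s * z) at_top"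
    by (rule Lim_transform_eventually) (rule eventually_mono[OF eventually_gt_at_top[of 0]], rule key)
qed

lemma has_bilateral_laplace_funpow_deriv:
  "has_bilateral_laplace T s z \<Longrightarrow> has_bilateral_laplace ((dist_deriv ^^ n) T) s (s ^ n * z)"
proof (induction n)
  case (Suc n)
  show ?case using has_bilateral_laplace_deriv[OF Suc.IH[OF Suc.prems]] by (simp add: mult.assoc)
qed simp

lemma causal_times_step:
  assumes "f \<in> real_functions" shows "causal (times_step f)"
proof -
  obtain g T where f: "locally_integrable g" "causal T" "f = regular g + T"
    using assms unfolding real_functions_iff by blast
  have "causal (regular (\<lambda>t. unit_step t * g t))"
  proof (rule causalI)
    fix \<phi> :: "real \<Rightarrow> real" and c :: real
    assume \<phi>: "test_function \<phi>" "c < 0" "\<And>t. c \<le> t \<Longrightarrow> \<phi> t = 0"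
    then have "unit_step t * g t * \<phi> t = 0" for t by (simp add: unit_step_def)
    then have "(LINT t|lborel. unit_step t * g t * \<phi> t) = 0" by (simp only: integral_zero)
    then show "pairing (regular (\<lambda>t. unit_step t * g t)) \<phi> = 0"
      by (simp add: pairing_regular[OF locally_integrable_unit_step[OF f(1)] \<phi>(1)])
  qed
  then show ?thesis
    unfolding f(3) times_step_eq[OF f(1,2)] by (rule causal_add[OF _ f(2)])
qed

lemma has_laplace_funpow_deriv_times_step:
  assumes f: "f \<in> real_functions" and "has_laplace f s z"
  shows "has_laplace ((dist_deriv ^^ n) (times_step f)) s (s ^ n * z)"
proof -
  have "times_step ((dist_deriv ^^ n) (times_step f)) = (dist_deriv ^^ n) (times_step f)"
    by (intro times_step_causal causal_funpow_deriv causal_times_step f)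
  then show ?thesis
    using has_bilateral_laplace_funpow_deriv[of "times_step f"] assms(2)
    unfolding has_laplace_def by simp
qed

theorem mainTheorem1:
  fixes f :: distribution and n :: nat
  assumes "f \<in> real_functions"
    and "\<exists>\<sigma> g. {s. Re s = \<sigma>} \<subseteq> laplace_domain f \<and>
           has_inverse_laplace (\<lambda>s. s ^ n * laplace f s) \<sigma> g"
  shows "\<forall>s\<in>laplace_domain f.
           s \<in> laplace_domain ((dist_deriv ^^ n) (times_step f)) \<and>
           laplace ((dist_deriv ^^ n) (times_step f)) s = s ^ n * laplace f s"
proof
  fix s assume "s \<in> laplace_domain f"
  then obtain z where s: "0 < Re s" and z: "has_laplace f s z"
    unfolding laplace_domain_def by blast
  note has_laplace_funpow_deriv_times_step[OF assms(1) z, of n]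
  then show "s \<in> laplace_domain ((dist_deriv ^^ n) (times_step f)) \<and>
      laplace ((dist_deriv ^^ n) (times_step f)) s = s ^ n * laplace f s"
    using s laplace_eqI[OF z] by (auto simp: laplace_domain_def intro: laplace_eqI)
qed

end
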